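(* Let $\mathbf{X}\sim\mathbb{P}_{\beta,\mathbf{Q},\boldsymbol{\mu}}$ where $\min_{i,j}\beta\mathbf{Q}_{ij}\ge0$ and $\|\mathbf{Q}\|_{\infty\to\infty}\le C_u'$ for some constant $C_u'>0$. Let $\mathcal{C}_n$ be a class of subsets of $[n]$ of size $s$, and suppose there are a constant $C_l>0$ and a sub-collection $\mathcal{C}_n'\subseteq\mathcal{C}_n$ of pairwise disjoint sets with $\log|\mathcal{C}_n'|\ge C_l\log n$. Consider testing $H_0:\boldsymbol{\mu}=\mathbf{0}$ against $H_1:\boldsymbol{\mu}\in\Xi(\mathcal{C}_n,s,A)$. Then there exist fixed constants $c',C>0$ such that the following hold. (I) Suppose there exist sequences $r_n,r_n'$ diverging to $+\infty$ with $r_n\ge C\log n$ such that - $\sup_{S\in\mathcal{C}_n'}\mathrm{Var}_{\beta,\mathbf{Q},\mathbf{0}}\big(\sum_{i\in S}X_i\big)\le r_n$; - $\sup_{S_1\neq S_2\in\mathcal{C}_n'}\mathrm{Cov}_{\beta,\mathbf{Q},\mathbf{0}}\big(\sum_{i\in S_1}X_i,\sum_{j\in S_2}X_j\big)=o(r_n')$. Then all tests are asymptotically powerless when $\tanh(A)\le c'\min\Big\{\sqrt{\frac{\log n}{r_n}},\sqrt{\frac{1}{r_n'}}\Big\}$. (II) Suppose there exist an increasing set $\Omega_n\subseteq\{-1,+1\}^n$, a constant $\kappa>0$, and sequences $r_n,r_n'$ diverging to $+\infty$ with $r_n\ge C\log n$ such that - $\sup_{\eta\in[0,A]}\sup_{S\in\mathcal{C}_n'}\mathrm{Var}_{\beta,\mathbf{Q},\boldsymbol{\mu}_S(2\eta)}\big(\sum_{i\in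 S}X_i\,\big|\,\Omega_n\big)\le r_n$; - $\sup_{\eta\in[0,A]}\sup_{S_1\neq S_2\in\mathcal{C}_n'}\Big|\mathrm{Var}_{\beta,\mathbf{Q},\boldsymbol{\mu}_{S_1\cup S_2}(\eta)}\big(\sum_{i\in S_1\cup S_2}X_i\big|\Omega_n\big)-\mathrm{Var}_{\beta,\mathbf{Q},\boldsymbol{\mu}_{S_1}(\eta)}\big(\sum_{i\in S_1}X_i\big|\Omega_n\big)-\mathrm{Var}_{\beta,\mathbf{Q},\boldsymbol{\mu}_{S_2}(\eta)}\big(\sum_{i\in S_2}X_i\big|\Omega_n\big)\Big|=o(r_n')$; - $\liminf_{n\to\infty}\mathbb{P}_{\beta,\mathbf{Q},\mathbf{0}}(\Omega_n)\ge\kappa$. Then no test is asymptotically powerful if $\tanh(A)\le c'\min\Big\{\sqrt{\frac{\log n}{r_n}},\sqrt{\frac{1}{r_n'}}\Big\}$.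
   Context: Ising model: for a symmetric real $n\times n$ matrix $\mathbf{Q}=\mathbf{Q}_n$ with zero diagonal, $\beta\in\mathbb{R}$ and $\boldsymbol{\mu}\in\mathbb{R}^n$, $\mathbb{P}_{\beta,\mathbf{Q},\boldsymbol{\mu}}$ is the law on $\{\pm1\}^n$ with $\mathbb{P}_{\beta,\mathbf{Q},\boldsymbol{\mu}}(\mathbf{X}=\mathbf{x})=\frac{1}{Z_n(\beta,\mathbf{Q},\boldsymbol{\mu})}\exp\big(\frac{\beta}{2}\mathbf{x}^\top\mathbf{Q}\mathbf{x}+\boldsymbol{\mu}^\top\mathbf{x}\big)$; $\mathrm{Var}_{\beta,\mathbf{Q},\boldsymbol{\mu}}$, $\mathrm{Cov}_{\beta,\mathbf{Q},\boldsymbol{\mu}}$ are the variance and covariance under it, and $\mathrm{Var}_{\beta,\mathbf{Q},\boldsymbol{\mu}}(\cdot|\Omega_n)$ is the variance under the law conditioned on $\mathbf{X}\in\Omega_n$. $\|\mathbf{Q}\|_{\infty\to\infty}=\max_i\sum_j|\mathbf{Q}_{ij}|$. For $S\subseteq[n]$ and $\eta\in\mathbb{R}$, $\boldsymbol{\mu}_S(\eta)$ is the vector with $i$-th coordinate $\eta\,\mathbf{1}(i\in S)$. A set $\Omega\subseteq\{-1,+1\}^n$ is increasing if $\mathbf{x}\in\Omega$ and $\mathbf{y}\ge\mathbf{x}$ coordinate-wise imply $\mathbf{y}\in\Omega$. Testing problem: $s=s_n\in[n]=\{1,\dots,n\}$ with $s\le n^{1-\upsilon}$ for some fixed $\upsilon>0$;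 $A=A_n>0$; every set in $\mathcal{C}_n$ has size $s$; $\Xi(\mathcal{C}_n,s,A)=\{\boldsymbol{\mu}\in\mathbb{R}_+^n:\ \mathrm{supp}(\boldsymbol{\mu})\in\mathcal{C}_n,\ \min_{i\in\mathrm{supp}(\boldsymbol{\mu})}\mu_i\ge A\}$, with $\mathrm{supp}(\boldsymbol{\mu})=\{i:\mu_i\neq0\}$. A test is a function $T:\{\pm1\}^n\to\{0,1\}$ ($1$ means reject $H_0$), with $\mathrm{Risk}(T)=\mathbb{P}_{\beta,\mathbf{Q},\mathbf{0}}(T(\mathbf{X})=1)+\sup_{\boldsymbol{\mu}\in\Xi(\mathcal{C}_n,s,A)}\mathbb{P}_{\beta,\mathbf{Q},\boldsymbol{\mu}}(T(\mathbf{X})=0)$. A sequence of tests $T_n$ is asymptotically powerful if $\limsup_n\mathrm{Risk}(T_n)=0$ and asymptotically powerless if $\liminf_n\mathrm{Risk}(T_n)=1$. "All tests are asymptotically powerless" means every sequence of tests is asymptotically powerless; "no test is asymptotically powerful" means no sequence of tests is asymptotically powerful. The constants $c',C$ do not depend on $n,s,A$; they may depend on the sequence $(\beta,\mathbf{Q})$ and on $C_l,C_u',\upsilon$.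
   Formalization: "Asymptotically powerless" is taken as liminf Risk(T_n) ≥ 1 instead of = 1: with equality (I) fails, since for Q = 0 and singleton sets the test rejecting iff X_1 = −1 has risk 3/2; for tests of risk at most 1 the two agree. *)

theory Defs
  imports "HOL-Probability.Probability"
begin

text \<open>
  The index set \<open>[n]\<close> is \<open>{1..n}\<close>.  Since \<open>n\<close> varies, vectors and matrices are functions on
  the naturals, of which only the entries with indices in \<open>{1..n}\<close> matter.  Spin configurations
  are the extensional functions below, so that there are exactly \<open>2 ^ n\<close> of them.
\<close>

definition spins :: "nat \<Rightarrow> (nat \<Rightarrow> real) set" where
  "spins n = {1..n} \<rightarrow>\<^sub>E {-1, 1}"

definition ising_weight ::
    "nat \<Rightarrow> real \<Rightarrow> (nat \<Rightarrow> nat \<Rightarrow> real) \<Rightarrow> (nat \<Rightarrow> real) \<Rightarrow> (nat \<Rightarrow> real) \<Rightarrow> real" where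
  "ising_weight n \<beta> Q \<mu> x =
     exp (\<beta> / 2 * (\<Sum>i\<in>{1..n}. \<Sum>j\<in>{1..n}. x i * Q i j * x j) + (\<Sum>i\<in>{1..n}. \<mu> i * x i))"

definition partition_fun ::
    "nat \<Rightarrow> real \<Rightarrow> (nat \<Rightarrow> nat \<Rightarrow> real) \<Rightarrow> (nat \<Rightarrow> real) \<Rightarrow> real" where
  "partition_fun n \<beta> Q \<mu> = (\<Sum>x\<in>spins n. ising_weight n \<beta> Q \<mu> x)"

definition ising ::
    "nat \<Rightarrow> real \<Rightarrow> (nat \<Rightarrow> nat \<Rightarrow> real) \<Rightarrow> (nat \<Rightarrow> real) \<Rightarrow> (nat \<Rightarrow> real) pmf" where
  "ising n \<beta> Q \<mu> =
     embed_pmf (\<lambda>x. if x \<in> spins n then ising_weight n \<beta> Q \<mu> x / partition_fun n \<beta> Q \<mu> else 0)"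

lemma finite_spins [simp]: "finite (spins n)"
  by (simp add: spins_def finite_PiE)

lemma spins_nonempty [simp]: "spins n \<noteq> {}"
  by (simp add: spins_def PiE_eq_empty_iff)

lemma ising_weight_pos: "ising_weight n \<beta> Q \<mu> x > 0"
  by (simp add: ising_weight_def)

lemma partition_fun_pos: "partition_fun n \<beta> Q \<mu> > 0"
  unfolding partition_fun_def by (intro sum_pos) (auto simp: ising_weight_pos)

lemma pmf_ising:
  "pmf (ising n \<beta> Q \<mu>) x =
     (if x \<in> spins n then ising_weight n \<beta> Q \<mu> x / partition_fun n \<beta> Q \<mu> else 0)"
proof -
  let ?f = "\<lambda>x. if x \<in> spins n then ising_weight n \<beta> Q \<mu> x / partition_fun n \<beta> Q \<mu> else 0"
  have nonneg: "?f x \<ge> 0" for x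
    using ising_weight_pos[of n \<beta> Q \<mu> x] partition_fun_pos[of n \<beta> Q \<mu>] by simp
  have "(\<integral>\<^sup>+x. ennreal (?f x) \<partial>count_space UNIV) = (\<Sum>x\<in>spins n. ennreal (?f x))"
    by (intro nn_integral_count_space') auto
  also have "\<dots> = ennreal (\<Sum>x\<in>spins n. ?f x)"
    using nonneg by (intro sum_ennreal) blast
  also have "(\<Sum>x\<in>spins n. ?f x) = 1"
    using partition_fun_pos[of n \<beta> Q \<mu>]
    by (simp add: sum_divide_distrib[symmetric] partition_fun_def[symmetric])
  finally show ?thesis
    unfolding ising_def using nonneg by (subst pmf_embed_pmf) auto
qed

definition covariance :: "'a pmf \<Rightarrow> ('a \<Rightarrow> real) \<Rightarrow> ('a \<Rightarrow> real) \<Rightarrow> real" where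
  "covariance p X Y =
     measure_pmf.expectation p
       (\<lambda>x. (X x - measure_pmf.expectation p X) * (Y x - measure_pmf.expectation p Y))"

definition inf_norm :: "nat \<Rightarrow> (nat \<Rightarrow> nat \<Rightarrow> real) \<Rightarrow> real" where
  "inf_norm n Q = (MAX i\<in>{1..n}. \<Sum>j\<in>{1..n}. \<bar>Q i j\<bar>)"

definition field_on :: "nat set \<Rightarrow> real \<Rightarrow> nat \<Rightarrow> real" where
  "field_on S \<eta> = (\<lambda>i. if i \<in> S then \<eta> else 0)"

definition increasing_set :: "nat \<Rightarrow> (nat \<Rightarrow> real) set \<Rightarrow> bool" where
  "increasing_set n \<Omega> \<longleftrightarrow>
     \<Omega> \<subseteq> spins n \<and> (\<forall>x\<in>\<Omega>. \<forall>y\<in>spins n. (\<forall>i\<in>{1..n}. x i \<le> y i) \<longrightarrow> y \<in> \<Omega>)"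

definition supp :: "nat \<Rightarrow> (nat \<Rightarrow> real) \<Rightarrow> nat set" where
  "supp n \<mu> = {i\<in>{1..n}. \<mu> i \<noteq> 0}"

definition alternatives :: "nat \<Rightarrow> nat set set \<Rightarrow> real \<Rightarrow> (nat \<Rightarrow> real) set" where
  "alternatives n \<C> A = {\<mu> \<in> {1..n} \<rightarrow> {0..}. supp n \<mu> \<in> \<C> \<and> (\<forall>i\<in>supp n \<mu>. \<mu> i \<ge> A)}"

text \<open>A test is a predicate on configurations; \<open>True\<close> means that the null hypothesis is rejected.\<close>

definition risk ::
    "nat \<Rightarrow> real \<Rightarrow> (nat \<Rightarrow> nat \<Rightarrow> real) \<Rightarrow> nat set set \<Rightarrow> real \<Rightarrow> ((nat \<Rightarrow> real) \<Rightarrow> bool) \<Rightarrow> real" where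
  "risk n \<beta> Q \<C> A T =
     measure_pmf.prob (ising n \<beta> Q (\<lambda>_. 0)) {x. T x} +
     (SUP \<mu>\<in>alternatives n \<C> A. measure_pmf.prob (ising n \<beta> Q \<mu>) {x. \<not> T x})"

definition asymptotically_powerful ::
    "(nat \<Rightarrow> real) \<Rightarrow> (nat \<Rightarrow> nat \<Rightarrow> nat \<Rightarrow> real) \<Rightarrow> (nat \<Rightarrow> nat set set) \<Rightarrow> (nat \<Rightarrow> real)
      \<Rightarrow> (nat \<Rightarrow> (nat \<Rightarrow> real) \<Rightarrow> bool) \<Rightarrow> bool" where
  "asymptotically_powerful \<beta> Q \<C> A T \<longleftrightarrow>
     limsup (\<lambda>n. ereal (risk n (\<beta> n) (Q n) (\<C> n) (A n) (T n))) = 0"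

text \<open>
  The risk takes values in \<open>[0, 2]\<close>, and the two constant tests have risk at most \<open>1\<close>.  The lower
  limit is required to be at least \<open>1\<close> rather than equal to \<open>1\<close>: a test that is worse than a
  constant one, such as rejecting iff \<open>x 1 = -1\<close>, can have risk bounded away from \<open>1\<close> from above, so
  with equality not every sequence of tests could ever be powerless.  For tests of risk
  at most \<open>1\<close> the two readings agree.
\<close>

definition asymptotically_powerless ::
    "(nat \<Rightarrow> real) \<Rightarrow> (nat \<Rightarrow> nat \<Rightarrow> nat \<Rightarrow> real) \<Rightarrow> (nat \<Rightarrow> nat set set) \<Rightarrow> (nat \<Rightarrow> real)
      \<Rightarrow> (nat \<Rightarrow> (nat \<Rightarrow> real) \<Rightarrow> bool) \<Rightarrow> bool" where
  "asymptotically_powerless \<beta> Q \<C> A T \<longleftrightarrow>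
     liminf (\<lambda>n. ereal (risk n (\<beta> n) (Q n) (\<C> n) (A n) (T n))) \<ge> 1"

end

theory Submission
  imports Defs
begin

text \<open>
  The risk is bounded below by the Bayes risk for the uniform prior on the fields \<open>A 1\<^sub>S\<close>,
  \<open>S \<in> \<C>'\<close>, and the latter by the second moment of the likelihood ratio.  That second moment is an
  average of ratios \<open>Z(S, S') Z(0) / (Z(S) Z(S'))\<close> of partition functions, and a second-order
  expansion of \<open>ln Z\<close> along the field turns variance bounds into bounds on these ratios: a diagonal
  term is at most \<open>exp (2 A\<^sup>2 r)\<close>, which is a small power of \<open>n\<close> and is beaten by the number of
  sets, and an off-diagonal one is \<open>exp (o(A\<^sup>2 r'))\<close>.

  In part (II) the argument is run for the laws conditioned on \<open>\<Omega>\<close>; by the FKG inequality every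
  alternative gives \<open>\<Omega>\<close> at least its null probability, so the conditional bound costs only a
  factor \<open>\<kappa>\<close>.  In part (I) the GHS inequality, in the form that covariances decrease in a nonnegative
  field, reduces the required variance bounds to the zero-field hypotheses, with \<open>\<Omega>\<close> the whole space.
\<close>

section \<open>Positivity for four rotated copies of a spin\<close>

text \<open>Half of a Hadamard matrix, hence an orthogonal map: a quadratic energy summed over four
  copies keeps its form in the rotated spins. The sign of the last row makes the product of the four
  coordinates +1 instead of -1 when all of them are \<plusminus>1, and it also gives the covariance
  difference positive coefficients.\<close>

fun rot :: "nat \<Rightarrow> real \<times> real \<times> real \<times> real \<Rightarrow> real" where
  "rot k (w, x, y, z) =
     (if k = 0 then w + x + y + z else if k = 1 then w + x - y - z
      else if k = 2 then w - x + y - z else x - w + y - z) / 2"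

definition quads :: "(real \<times> real \<times> real \<times> real) set" where
  "quads = {-1, 1} \<times> {-1, 1} \<times> {-1, 1} \<times> {-1, 1}"

lemma finite_quads [simp]: "finite quads"
  by (simp add: quads_def)

definition rot_monom ::
    "'i set \<Rightarrow> ('i \<times> nat \<Rightarrow> nat) \<Rightarrow> ('i \<Rightarrow> real \<times> real \<times> real \<times> real) \<Rightarrow> real" where
  "rot_monom V e \<omega> = (\<Prod>p\<in>V \<times> {..<4}. rot (snd p) (\<omega> (fst p)) ^ e p)"

text \<open>Positivity is tested against every monomial in the rotated spins, and not just against
  the constant one, because this larger family is stable under multiplication by a rotated
  spin.\<close>

definition rot_pos :: "'i set \<Rightarrow> (('i \<Rightarrow> real \<times> real \<times> real \<times> real) \<Rightarrow> real) \<Rightarrow> bool" where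
  "rot_pos V f \<longleftrightarrow> (\<forall>e. 0 \<le> (\<Sum>\<omega>\<in>V \<rightarrow>\<^sub>E quads. rot_monom V e \<omega> * f \<omega>))"

text \<open>Multipliers preserving positivity. In this form closure under products is mere
  composition, so polynomials with nonnegative coefficients and their exponentials can be built up
  step by step.\<close>

definition rot_mult :: "'i set \<Rightarrow> (('i \<Rightarrow> real \<times> real \<times> real \<times> real) \<Rightarrow> real) \<Rightarrow> bool" where
  "rot_mult V g \<longleftrightarrow> (\<forall>f. rot_pos V f \<longrightarrow> rot_pos V (\<lambda>\<omega>. g \<omega> * f \<omega>))"

text \<open>
  At a single site either one of the four rotated spins is \<open>\<plusminus>2\<close> and the others vanish, or all four
  are \<open>\<plusminus>1\<close> with product \<open>1\<close>; the five summands below correspond to these cases.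
\<close>

lemma single_site_pos: "0 \<le> (\<Sum>t\<in>quads. \<Prod>k<4. rot k t ^ e k)"
proof -
  have "(\<Sum>t\<in>quads. \<Prod>k<4. rot k t ^ e k) =
     (2 ^ e 0 + (-2) ^ e 0) * (0 ^ e 1 * 0 ^ e 2 * 0 ^ e 3) +
     (2 ^ e 1 + (-2) ^ e 1) * (0 ^ e 0 * 0 ^ e 2 * 0 ^ e 3) +
     (2 ^ e 2 + (-2) ^ e 2) * (0 ^ e 0 * 0 ^ e 1 * 0 ^ e 3) +
     (2 ^ e 3 + (-2) ^ e 3) * (0 ^ e 0 * 0 ^ e 1 * 0 ^ e 2) +
     (1 + (-1) ^ e 0 * (-1) ^ e 1 * (-1) ^ e 2 * (-1) ^ e 3) *
       (1 + (-1) ^ e 2 * (-1) ^ e 3 + (-1) ^ e 1 * (-1) ^ e 3 + (-1) ^ e 1 * (-1) ^ e 2 :: real)"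
    unfolding quads_def sum.cartesian_product[symmetric]
    by (cases "even (e 0)"; cases "even (e 1)"; cases "even (e 2)"; cases "even (e 3)")
       (simp_all add: sum.insert lessThan_Suc eval_nat_numeral)
  moreover have "0 \<le> 2 ^ m + (-2 :: real) ^ m" for m
    by (cases "even m") simp_all
  moreover have "0 \<le> (1 + (-1) ^ e 0 * (-1) ^ e 1 * (-1) ^ e 2 * (-1) ^ e 3) *
       (1 + (-1) ^ e 2 * (-1) ^ e 3 + (-1) ^ e 1 * (-1) ^ e 3 + (-1) ^ e 1 * (-1) ^ e 2 :: real)"
    by (cases "even (e 0)"; cases "even (e 1)"; cases "even (e 2)"; cases "even (e 3)") simp_all
  ultimately show ?thesis
    by (simp add: add_nonneg_nonneg)
qed

text \<open>The uniform sum of a monomial factorises over the sites, and each factor is a one-site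
  sum.\<close>

lemma rot_pos_one:
  assumes "finite V"
  shows "rot_pos V (\<lambda>_. 1)"
  unfolding rot_pos_def
proof
  fix e :: "'a \<times> nat \<Rightarrow> nat"
  have "(\<Sum>\<omega>\<in>V \<rightarrow>\<^sub>E quads. rot_monom V e \<omega> * 1) =
        (\<Sum>\<omega>\<in>V \<rightarrow>\<^sub>E quads. \<Prod>i\<in>V. \<Prod>k<4. rot k (\<omega> i) ^ e (i, k))"
    by (simp add: rot_monom_def prod.cartesian_product split_def)
  also have "\<dots> = (\<Prod>i\<in>V. \<Sum>t\<in>quads. \<Prod>k<4. rot k t ^ e (i, k))"
    using assms by (subst prod_sum_PiE) simp_all
  also have "\<dots> \<ge> 0"
    by (intro prod_nonneg single_site_pos)
  finally show "0 \<le> (\<Sum>\<omega>\<in>V \<rightarrow>\<^sub>E quads. rot_monom V e \<omega> * 1)" .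
qed

lemma rot_pos_nonneg:
  assumes "rot_pos V f"
  shows "0 \<le> (\<Sum>\<omega>\<in>V \<rightarrow>\<^sub>E quads. f \<omega>)"
  using assms[unfolded rot_pos_def, rule_format, of "\<lambda>_. 0"] by (simp add: rot_monom_def)

text \<open>Multiplying by a rotated spin raises one exponent by one, so the sum to be bounded is
  again a test of \<open>f\<close> against a monomial.\<close>

lemma rot_mult_rot:
  assumes "finite V" "i \<in> V" "k < 4"
  shows "rot_mult V (\<lambda>\<omega>. rot k (\<omega> i))"
  unfolding rot_mult_def rot_pos_def
proof (intro allI impI)
  fix f e assume f: "\<forall>e. 0 \<le> (\<Sum>\<omega>\<in>V \<rightarrow>\<^sub>E quads. rot_monom V e \<omega> * f \<omega>)"
  have "rot_monom V (e((i, k) := Suc (e (i, k)))) \<omega> = rot_monom V e \<omega> * rot k (\<omega> i)" for \<omega>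
    unfolding rot_monom_def using assms
    by (subst (1 2) prod.remove[of _ "(i, k)"]) (auto intro!: prod.cong)
  then have "(\<Sum>\<omega>\<in>V \<rightarrow>\<^sub>E quads. rot_monom V e \<omega> * (rot k (\<omega> i) * f \<omega>)) =
      (\<Sum>\<omega>\<in>V \<rightarrow>\<^sub>E quads. rot_monom V (e((i, k) := Suc (e (i, k)))) \<omega> * f \<omega>)"
    by (simp add: mult.assoc)
  then show "0 \<le> (\<Sum>\<omega>\<in>V \<rightarrow>\<^sub>E quads. rot_monom V e \<omega> * (rot k (\<omega> i) * f \<omega>))"
    using f by simp
qed

lemma rot_mult_const: "0 \<le> c \<Longrightarrow> rot_mult V (\<lambda>_. c)"
  by (simp add: rot_mult_def rot_pos_def mult.left_commute[of _ c] flip: sum_distrib_left)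

lemma rot_mult_add: "rot_mult V f \<Longrightarrow> rot_mult V g \<Longrightarrow> rot_mult V (\<lambda>\<omega>. f \<omega> + g \<omega>)"
  by (simp add: rot_mult_def rot_pos_def distrib_right distrib_left sum.distrib)

lemma rot_mult_mult: "rot_mult V f \<Longrightarrow> rot_mult V g \<Longrightarrow> rot_mult V (\<lambda>\<omega>. f \<omega> * g \<omega>)"
  by (simp add: rot_mult_def mult.assoc)

lemma rot_mult_sum: "(\<And>i. i \<in> I \<Longrightarrow> rot_mult V (f i)) \<Longrightarrow> rot_mult V (\<lambda>\<omega>. \<Sum>i\<in>I. f i \<omega>)"
  by (induction I rule: infinite_finite_induct) (simp_all add: rot_mult_const rot_mult_add)

lemma rot_mult_power: "rot_mult V f \<Longrightarrow> rot_mult V (\<lambda>\<omega>. f \<omega> ^ m)"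
  by (induction m) (simp_all add: rot_mult_const rot_mult_mult)

text \<open>The partial sums of the exponential series are multipliers, and the inequality passes to
  the limit because the sum over configurations is finite.\<close>

lemma rot_mult_exp:
  assumes "rot_mult V g"
  shows "rot_mult V (\<lambda>\<omega>. exp (g \<omega>))"
  unfolding rot_mult_def rot_pos_def
proof (intro allI impI)
  fix f e assume f: "\<forall>e. 0 \<le> (\<Sum>\<omega>\<in>V \<rightarrow>\<^sub>E quads. rot_monom V e \<omega> * f \<omega>)"
  have "rot_mult V (\<lambda>\<omega>. \<Sum>m<N. inverse (fact m) * g \<omega> ^ m)" for N
    by (intro rot_mult_sum rot_mult_mult rot_mult_const rot_mult_power assms) simp
  with f have "0 \<le> (\<Sum>\<omega>\<in>V \<rightarrow>\<^sub>E quads. rot_monom V e \<omega> *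
      ((\<Sum>m<N. inverse (fact m) * g \<omega> ^ m) * f \<omega>))" for N
    by (simp add: rot_mult_def rot_pos_def)
  moreover have "(\<lambda>N. \<Sum>m<N. inverse (fact m) * g \<omega> ^ m) \<longlonglongrightarrow> exp (g \<omega>)" for \<omega>
    using exp_converges[of "g \<omega>"] by (simp add: sums_def)
  then have "(\<lambda>N. \<Sum>\<omega>\<in>V \<rightarrow>\<^sub>E quads. rot_monom V e \<omega> *
      ((\<Sum>m<N. inverse (fact m) * g \<omega> ^ m) * f \<omega>)) \<longlonglongrightarrow>
      (\<Sum>\<omega>\<in>V \<rightarrow>\<^sub>E quads. rot_monom V e \<omega> * (exp (g \<omega>) * f \<omega>))"
    by (intro tendsto_intros)
  ultimately show "0 \<le> (\<Sum>\<omega>\<in>V \<rightarrow>\<^sub>E quads. rot_monom V e \<omega> * (exp (g \<omega>) * f \<omega>))"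
    by (intro LIMSEQ_le_const) auto
qed

text \<open>A configuration of quadruples is the same as a quadruple of configurations. This passes
  from four independent copies of the system to a single system with four spins per site, where
  \<open>rot\<close> acts.\<close>

lemma sum_quads_copies:
  fixes F :: "('i \<Rightarrow> real) \<Rightarrow> ('i \<Rightarrow> real) \<Rightarrow> ('i \<Rightarrow> real) \<Rightarrow> ('i \<Rightarrow> real) \<Rightarrow> real"
  assumes "\<And>\<omega>. \<omega> \<in> V \<rightarrow>\<^sub>E quads \<Longrightarrow>
    G \<omega> = F (\<lambda>i\<in>V. fst (\<omega> i)) (\<lambda>i\<in>V. fst (snd (\<omega> i)))
            (\<lambda>i\<in>V. fst (snd (snd (\<omega> i)))) (\<lambda>i\<in>V. snd (snd (snd (\<omega> i))))"
  shows "(\<Sum>w\<in>V \<rightarrow>\<^sub>E {-1, 1}. \<Sum>x\<in>V \<rightarrow>\<^sub>E {-1, 1}. \<Sum>y\<in>V \<rightarrow>\<^sub>E {-1, 1}. \<Sum>z\<in>V \<rightarrow>\<^sub>E {-1, 1}.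
           F w x y z) = (\<Sum>\<omega>\<in>V \<rightarrow>\<^sub>E quads. G \<omega>)"
proof -
  let ?S = "V \<rightarrow>\<^sub>E {-1, 1 :: real}"
  let ?i = "\<lambda>(w, x, y, z). \<lambda>i\<in>V. (w i, x i, y i, z i :: real)"
  let ?j = "\<lambda>\<omega>. (\<lambda>i\<in>V. fst (\<omega> i), \<lambda>i\<in>V. fst (snd (\<omega> i)),
            \<lambda>i\<in>V. fst (snd (snd (\<omega> i))), \<lambda>i\<in>V. snd (snd (snd (\<omega> i))))"
  have "(\<Sum>(w, x, y, z)\<in>?S \<times> ?S \<times> ?S \<times> ?S. F w x y z) = (\<Sum>\<omega>\<in>V \<rightarrow>\<^sub>E quads. G \<omega>)"
  proof (rule sum.reindex_bij_witness[where i = ?j and j = ?i])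
    fix p assume "p \<in> ?S \<times> ?S \<times> ?S \<times> ?S"
    then obtain w x y z where p: "p = (w, x, y, z)" "w \<in> ?S" "x \<in> ?S" "y \<in> ?S" "z \<in> ?S"
      by (metis mem_Times_iff prod.collapse)
    have [simp]: "(\<lambda>i\<in>V. f i) = f" if "f \<in> ?S" for f
      using that by (simp add: PiE_def extensional_restrict)
    show jp: "?j (?i p) = p"
      using p by (simp cong: restrict_cong)
    show ip: "?i p \<in> V \<rightarrow>\<^sub>E quads"
      unfolding p(1) prod.case restrict_PiE_iff quads_def
      using p(2-)[THEN PiE_mem] by (simp only: mem_Times_iff fst_conv snd_conv) simp
    show "G (?i p) = (case p of (w, x, y, z) \<Rightarrow> F w x y z)"
      using assms[OF ip] jp unfolding p(1) by (simp del: restrict_apply)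
  next
    fix \<omega> assume \<omega>: "\<omega> \<in> V \<rightarrow>\<^sub>E quads"
    show "?i (?j \<omega>) = \<omega>"
      using \<omega> by (auto simp: fun_eq_iff restrict_def PiE_def extensional_def)
    have "\<omega> i \<in> quads" if "i \<in> V" for i
      using \<omega> that by (rule PiE_mem)
    then have "fst (\<omega> i) \<in> {-1, 1} \<and> fst (snd (\<omega> i)) \<in> {-1, 1} \<and> fst (snd (snd (\<omega> i))) \<in> {-1, 1} \<and>
        snd (snd (snd (\<omega> i))) \<in> {-1, 1}" if "i \<in> V" for i
      using that unfolding quads_def mem_Times_iff by blast
    then show "?j \<omega> \<in> ?S \<times> ?S \<times> ?S \<times> ?S"
      unfolding mem_Times_iff fst_conv snd_conv restrict_PiE_iff by blast
  qed
  then show ?thesis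
    by (simp add: sum.cartesian_product split_def)
qed

section \<open>The GHS inequality\<close>

text \<open>The weight is left unnormalised and the ground set is a parameter, so that one notion
  covers an Ising law, its conditioning on an event and its exponential tilts.\<close>

definition gmean :: "'a set \<Rightarrow> ('a \<Rightarrow> real) \<Rightarrow> ('a \<Rightarrow> real) \<Rightarrow> real" where
  "gmean \<Omega> W f = (\<Sum>x\<in>\<Omega>. W x * f x) / (\<Sum>x\<in>\<Omega>. W x)"

definition gcov :: "'a set \<Rightarrow> ('a \<Rightarrow> real) \<Rightarrow> ('a \<Rightarrow> real) \<Rightarrow> ('a \<Rightarrow> real) \<Rightarrow> real" where
  "gcov \<Omega> W f g = gmean \<Omega> W (\<lambda>x. f x * g x) - gmean \<Omega> W f * gmean \<Omega> W g"

text \<open>Symmetrisation over two independent copies: the product of differences expands into two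
  diagonal and two cross terms. The denominators are cleared so that covariances for different
  weights can be combined into one sum.\<close>

lemma gcov_two_copies:
  assumes "(\<Sum>x\<in>\<Omega>. W x) \<noteq> 0"
  shows "2 * (\<Sum>x\<in>\<Omega>. W x)\<^sup>2 * gcov \<Omega> W f g =
    (\<Sum>x\<in>\<Omega>. \<Sum>y\<in>\<Omega>. W x * W y * ((f x - f y) * (g x - g y)))"
proof -
  let ?I = "\<lambda>f. \<Sum>x\<in>\<Omega>. W x * f x"
  have "(\<Sum>x\<in>\<Omega>. \<Sum>y\<in>\<Omega>. W x * W y * ((f x - f y) * (g x - g y))) =
    (\<Sum>x\<in>\<Omega>. \<Sum>y\<in>\<Omega>. (W x * (f x * g x)) * W y + W x * (W y * (f y * g y))
        - (W x * f x) * (W y * g y) - (W x * g x) * (W y * f y))"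
    by (simp add: algebra_simps)
  also have "\<dots> = 2 * (?I (\<lambda>x. f x * g x) * (\<Sum>x\<in>\<Omega>. W x) - ?I f * ?I g)"
    unfolding sum.distrib sum_subtractf sum_product[symmetric] by (simp add: algebra_simps)
  also have "\<dots> = 2 * (\<Sum>x\<in>\<Omega>. W x)\<^sup>2 * gcov \<Omega> W f g"
    using assms by (simp add: gcov_def gmean_def field_simps power2_eq_square)
  finally show ?thesis ..
qed

text \<open>
  Ellis--Monroe--Newman: in the variables \<open>rot\<close>, four independent copies, two in the field \<open>h\<close>
  and two in the field \<open>h'\<close>, have a Gibbs weight whose exponent has nonnegative coefficients, and
  so has the polynomial representing the difference of the two covariances.
\<close>

lemma ghs_inequality:
  assumes ferro: "\<And>i j. i \<in> {1..n} \<Longrightarrow> j \<in> {1..n} \<Longrightarrow> 0 \<le> \<beta> * Q i j"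
    and h: "\<And>i. i \<in> {1..n} \<Longrightarrow> 0 \<le> h' i \<and> h' i \<le> h i"
    and S: "S \<subseteq> {1..n}" "S' \<subseteq> {1..n}"
  shows "gcov (spins n) (ising_weight n \<beta> Q h) (\<lambda>x. \<Sum>i\<in>S. x i) (\<lambda>x. \<Sum>i\<in>S'. x i)
       \<le> gcov (spins n) (ising_weight n \<beta> Q h') (\<lambda>x. \<Sum>i\<in>S. x i) (\<lambda>x. \<Sum>i\<in>S'. x i)"
proof -
  let ?V = "{1..n}"
  let ?W = "ising_weight n \<beta> Q h" and ?W' = "ising_weight n \<beta> Q h'"
  let ?u = "\<lambda>x. \<Sum>i\<in>S. x i :: real" and ?v = "\<lambda>x. \<Sum>i\<in>S'. x i :: real"
  let ?Z = "\<Sum>x\<in>spins n. ?W x" and ?Z' = "\<Sum>x\<in>spins n. ?W' x"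
  have Z: "?Z > 0" "?Z' > 0"
    using partition_fun_pos by (simp_all add: partition_fun_def)
  define R where "R k i \<omega> = rot k (\<omega> i)" for k and i :: nat and \<omega>
  \<comment> \<open>The quadratic part is unchanged by orthogonality of \<open>rot\<close>. For the
    linear part, \<open>R 0 + R 1 = w + x\<close> and \<open>R 0 - R 1 = y + z\<close> at each site,
    which turns \<open>h (w + x) + h' (y + z)\<close> into
    \<open>(h + h') R 0 + (h - h') R 1\<close>; both coefficients are nonnegative.\<close>
  define E where "E \<omega> = (\<Sum>i\<in>?V. \<Sum>j\<in>?V. \<beta> * Q i j / 2 * (R 0 i \<omega> * R 0 j \<omega> +
      R 1 i \<omega> * R 1 j \<omega> + R 2 i \<omega> * R 2 j \<omega> + R 3 i \<omega> * R 3 j \<omega>)) +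
      (\<Sum>i\<in>?V. (h i + h' i) * R 0 i \<omega> + (h i - h' i) * R 1 i \<omega>)" for \<omega>
  \<comment> \<open>Since \<open>y - z = R 2 + R 3\<close> and \<open>x - w = R 3 - R 2\<close>, the
    squares cancel in the difference of the two products of differences, and only these mixed terms
    remain.\<close>
  define P where "P \<omega> = (\<Sum>i\<in>S. \<Sum>j\<in>S'. 2 * (R 2 i \<omega> * R 3 j \<omega> + R 3 i \<omega> * R 2 j \<omega>))" for \<omega>
  define F where "F w x y z = ?W w * ?W x * (?W' y * ?W' z) *
      ((?u y - ?u z) * (?v y - ?v z) - (?u w - ?u x) * (?v w - ?v x))" for w x y z
  \<comment> \<open>Each covariance is written over its own two copies and multiplied by the total
    weight of the other two: \<open>w\<close>, \<open>x\<close> live in the field \<open>h\<close>,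
    and \<open>y\<close>, \<open>z\<close> in \<open>h'\<close>.\<close>
  have "2 * (?Z * ?Z')\<^sup>2 * (gcov (spins n) ?W' ?u ?v - gcov (spins n) ?W ?u ?v) =
      (\<Sum>w\<in>spins n. \<Sum>x\<in>spins n. ?W w * ?W x) *
        (\<Sum>y\<in>spins n. \<Sum>z\<in>spins n. ?W' y * ?W' z * ((?u y - ?u z) * (?v y - ?v z))) -
      (\<Sum>w\<in>spins n. \<Sum>x\<in>spins n. ?W w * ?W x * ((?u w - ?u x) * (?v w - ?v x))) *
        (\<Sum>y\<in>spins n. \<Sum>z\<in>spins n. ?W' y * ?W' z)"
    using Z by (simp flip: gcov_two_copies sum_product) (simp add: algebra_simps power2_eq_square)
  also have "\<dots> = (\<Sum>w\<in>spins n. \<Sum>x\<in>spins n. \<Sum>y\<in>spins n. \<Sum>z\<in>spins n. F w x y z)"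
  proof -
    have prod4: "(\<Sum>w\<in>X. \<Sum>x\<in>X. a w x) * (\<Sum>y\<in>X. \<Sum>z\<in>X. b y z) =
        (\<Sum>w\<in>X. \<Sum>x\<in>X. \<Sum>y\<in>X. \<Sum>z\<in>X. a w x * b y z)" for X :: "(nat \<Rightarrow> real) set"
        and a b :: "(nat \<Rightarrow> real) \<Rightarrow> (nat \<Rightarrow> real) \<Rightarrow> real"
      by (simp only: sum_distrib_right) (simp only: sum_distrib_left)
    show ?thesis
      unfolding prod4 sum_subtractf[symmetric] F_def
      by (intro sum.cong refl) (simp only: right_diff_distrib mult_ac)
  qed
  also have "\<dots> = (\<Sum>\<omega>\<in>?V \<rightarrow>\<^sub>E quads. exp (E \<omega>) * P \<omega>)"
    unfolding spins_def
  proof (rule sum_quads_copies)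
    fix \<omega> :: "nat \<Rightarrow> real \<times> real \<times> real \<times> real"
    define w x y z where "w = (\<lambda>i\<in>?V. fst (\<omega> i))" and "x = (\<lambda>i\<in>?V. fst (snd (\<omega> i)))"
      and "y = (\<lambda>i\<in>?V. fst (snd (snd (\<omega> i))))" and "z = (\<lambda>i\<in>?V. snd (snd (snd (\<omega> i))))"
    have \<omega>: "\<omega> i = (w i, x i, y i, z i)" if "i \<in> ?V" for i
      using that by (simp add: w_def x_def y_def z_def)
    have R: "R 0 i \<omega> = (w i + x i + y i + z i) / 2" "R 1 i \<omega> = (w i + x i - y i - z i) / 2"
       "R 2 i \<omega> = (w i - x i + y i - z i) / 2" "R 3 i \<omega> = (x i - w i + y i - z i) / 2"
      if "i \<in> ?V" for i
      using \<omega>[OF that] by (simp_all add: R_def)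
    have "?W w * ?W x * (?W' y * ?W' z) = exp (
        ((\<Sum>i\<in>?V. \<Sum>j\<in>?V. \<beta> / 2 * (w i * Q i j * w j)) + (\<Sum>i\<in>?V. \<Sum>j\<in>?V. \<beta> / 2 * (x i * Q i j * x j)) +
         (\<Sum>i\<in>?V. \<Sum>j\<in>?V. \<beta> / 2 * (y i * Q i j * y j)) + (\<Sum>i\<in>?V. \<Sum>j\<in>?V. \<beta> / 2 * (z i * Q i j * z j))) +
        ((\<Sum>i\<in>?V. h i * w i) + (\<Sum>i\<in>?V. h i * x i) + (\<Sum>i\<in>?V. h' i * y i) + (\<Sum>i\<in>?V. h' i * z i)))"
      by (simp add: ising_weight_def mult_exp_exp sum_distrib_left algebra_simps)
    also have "\<dots> = exp (E \<omega>)"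
      unfolding E_def sum.distrib[symmetric]
      by (rule arg_cong[where f = exp], rule sum.cong[OF refl],
          rule arg_cong2[where f = "(+)"], rule sum.cong[OF refl])
         (simp_all only: R, simp_all add: field_simps)
    finally have W: "?W w * ?W x * (?W' y * ?W' z) = exp (E \<omega>)" .
    have "(?u y - ?u z) * (?v y - ?v z) - (?u w - ?u x) * (?v w - ?v x) = P \<omega>"
      unfolding P_def sum_subtractf[symmetric] sum_product
      by (intro sum.cong refl) (use S in \<open>simp add: R subset_eq\<close>, simp add: field_simps)
    with W show "exp (E \<omega>) * P \<omega> = F w x y z"
      by (simp add: F_def)
  qed
  also have "\<dots> \<ge> 0"
  proof -
    have R: "rot_mult ?V (R k i)" if "i \<in> ?V" "k < 4" for k i
      using rot_mult_rot[OF _ that] by (simp add: R_def [abs_def])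
    have "rot_mult ?V E"
      unfolding E_def [abs_def] using h order_trans[OF conjunct1[OF h] conjunct2[OF h]]
      by (intro rot_mult_add rot_mult_sum rot_mult_mult rot_mult_const R)
         (auto simp: ferro add_nonneg_nonneg)
    moreover have "rot_mult ?V P"
      unfolding P_def [abs_def] using S
      by (intro rot_mult_add rot_mult_sum rot_mult_mult rot_mult_const R) auto
    ultimately have "rot_mult ?V (\<lambda>\<omega>. exp (E \<omega>) * P \<omega>)"
      by (intro rot_mult_mult rot_mult_exp)
    \<comment> \<open>The multiplier acts on the constant 1; testing the result against the trivial
      monomial gives the desired sum.\<close>
    then have "rot_pos ?V (\<lambda>\<omega>. exp (E \<omega>) * P \<omega> * 1)"
      using rot_pos_one[of ?V] unfolding rot_mult_def by blast
    from rot_pos_nonneg[OF this] show ?thesis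
      by simp
  qed
  finally show ?thesis
    using Z by (simp add: zero_le_mult_iff)
qed

section \<open>The FKG inequality\<close>

lemma sum_PiE_signs_insert:
  fixes F :: "('i \<Rightarrow> real) \<Rightarrow> real"
  assumes "v \<notin> V"
  shows "(\<Sum>x\<in>insert v V \<rightarrow>\<^sub>E {-1, 1}. F x) =
         (\<Sum>x\<in>V \<rightarrow>\<^sub>E {-1, 1}. F (x(v := 1))) + (\<Sum>x\<in>V \<rightarrow>\<^sub>E {-1, 1}. F (x(v := -1)))"
proof -
  have "(\<Sum>x\<in>insert v V \<rightarrow>\<^sub>E {-1, 1}. F x) =
      (\<Sum>p\<in>{-1, 1} \<times> (V \<rightarrow>\<^sub>E {-1, 1}). F ((snd p)(v := fst p)))"
    unfolding PiE_insert_eq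
    by (subst sum.reindex[OF inj_combinator[OF assms]]) (simp add: split_def)
  also have "\<dots> = (\<Sum>s\<in>{-1, 1}. \<Sum>x\<in>V \<rightarrow>\<^sub>E {-1, 1}. F (x(v := s)))"
    by (simp add: sum.cartesian_product split_def)
  finally show ?thesis by simp
qed

text \<open>The law of total covariance for a two-valued spin: \<open>IH\<close> bounds the
  covariances given the spin, and \<open>mono\<close> says that both conditional means move in the
  same direction, so that the product of their increments is nonnegative.\<close>

lemma fkg_two_point:
  fixes Z1 Z0 F1 F0 G1 G0 H1 H0 :: real
  assumes Z: "Z1 > 0" "Z0 > 0"
    and IH: "F1 * G1 \<le> Z1 * H1" "F0 * G0 \<le> Z0 * H0"
    and mono: "Z1 * F0 \<le> Z0 * F1" "Z1 * G0 \<le> Z0 * G1"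
  shows "(F1 + F0) * (G1 + G0) \<le> (Z1 + Z0) * (H1 + H0)"
proof -
  have "0 \<le> (Z0 * F1 - Z1 * F0) * (Z0 * G1 - Z1 * G0)"
    using mono by simp
  then have "(Z0 * Z1) * ((F1 + F0) * (G1 + G0)) \<le>
      (Z1 + Z0) * (Z0 * (F1 * G1) + Z1 * (F0 * G0))"
    by (simp add: algebra_simps)
  also have "\<dots> \<le> (Z1 + Z0) * (Z0 * (Z1 * H1) + Z1 * (Z0 * H0))"
    using Z IH by (intro mult_left_mono add_mono) simp_all
  also have "\<dots> = (Z0 * Z1) * ((Z1 + Z0) * (H1 + H0))"
    by (simp add: algebra_simps)
  finally show ?thesis
    using Z by (simp add: mult_le_cancel_left_pos)
qed

text \<open>Induction on the sites, by conditioning on the spin at the new site. The hypothesis on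
  \<open>w\<close> says that the odds of a plus at \<open>v\<close> increase with the configuration;
  unlike the conclusion, it is visibly inherited when another spin is fixed.\<close>

lemma fkg_inequality:
  fixes w f g :: "('i \<Rightarrow> real) \<Rightarrow> real"
  assumes "finite V"
    and "\<And>x. x \<in> V \<rightarrow>\<^sub>E {-1, 1} \<Longrightarrow> w x > 0"
    and "\<And>v a b. v \<in> V \<Longrightarrow> a \<in> V \<rightarrow>\<^sub>E {-1, 1} \<Longrightarrow> b \<in> V \<rightarrow>\<^sub>E {-1, 1} \<Longrightarrow>
      \<forall>i\<in>V. a i \<le> b i \<Longrightarrow> w (a(v := 1)) * w (b(v := -1)) \<le> w (b(v := 1)) * w (a(v := -1))"
    and "\<And>a b. a \<in> V \<rightarrow>\<^sub>E {-1, 1} \<Longrightarrow> b \<in> V \<rightarrow>\<^sub>E {-1, 1} \<Longrightarrow> \<forall>i\<in>V. a i \<le> b i \<Longrightarrow> f a \<le> f b"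
    and "\<And>a b. a \<in> V \<rightarrow>\<^sub>E {-1, 1} \<Longrightarrow> b \<in> V \<rightarrow>\<^sub>E {-1, 1} \<Longrightarrow> \<forall>i\<in>V. a i \<le> b i \<Longrightarrow> g a \<le> g b"
  shows "(\<Sum>x\<in>V \<rightarrow>\<^sub>E {-1, 1}. w x * f x) * (\<Sum>x\<in>V \<rightarrow>\<^sub>E {-1, 1}. w x * g x)
       \<le> (\<Sum>x\<in>V \<rightarrow>\<^sub>E {-1, 1}. w x) * (\<Sum>x\<in>V \<rightarrow>\<^sub>E {-1, 1}. w x * (f x * g x))"
  using assms
proof (induction V arbitrary: w f g rule: finite_induct)
  case empty
  show ?case by (simp add: algebra_simps)
next
  case (insert v V)
  note pos = insert.prems(1) and ratio = insert.prems(2)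
  let ?S = "V \<rightarrow>\<^sub>E {-1, 1 :: real}"
  have finS: "finite ?S" and neS: "?S \<noteq> {}"
    using insert.hyps by (simp_all add: finite_PiE PiE_eq_empty_iff)
  have up: "x(v := s) \<in> insert v V \<rightarrow>\<^sub>E {-1, 1}" if "x \<in> ?S" "s \<in> {-1, 1}" for x s
    using that insert.hyps by (auto simp: PiE_insert_eq image_iff)
  have s: "1 \<in> {-1, 1 :: real}" "-1 \<in> {-1, 1 :: real}"
    by simp_all
  note up1 = up[OF _ s(1)] and dn1 = up[OF _ s(2)]
  have le: "\<forall>i\<in>insert v V. (a(v := s)) i \<le> (b(v := s')) i"
    if "\<forall>i\<in>V. a i \<le> b i" "s \<le> s'" for a b :: "'i \<Rightarrow> real" and s s' :: real
    using that by simp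
  let ?w = "\<lambda>s x. w (x(v := s))"
  have pos': "?w s x > 0" if "x \<in> ?S" "s \<in> {-1, 1}" for s x
    by (rule pos[OF up[OF that]])
  have ratio': "?w s (a(u := 1)) * ?w s (b(u := -1)) \<le> ?w s (b(u := 1)) * ?w s (a(u := -1))"
    if "s \<in> {-1, 1}" "u \<in> V" "a \<in> ?S" "b \<in> ?S" "\<forall>i\<in>V. a i \<le> b i" for s u a b
  proof -
    have "u \<noteq> v"
      using that(2) insert.hyps(2) by blast
    then show ?thesis
      unfolding fun_upd_twist[OF \<open>u \<noteq> v\<close>]
      by (intro ratio[OF insertI2[OF that(2)] up[OF that(3,1)] up[OF that(4,1)] le[OF that(5) order_refl]])
  qed
  have IH: "(\<Sum>x\<in>?S. ?w s x * f' x) * (\<Sum>x\<in>?S. ?w s x * g' x)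
      \<le> (\<Sum>x\<in>?S. ?w s x) * (\<Sum>x\<in>?S. ?w s x * (f' x * g' x))"
    if "s \<in> {-1, 1}"
      and "\<And>a b. a \<in> ?S \<Longrightarrow> b \<in> ?S \<Longrightarrow> \<forall>i\<in>V. a i \<le> b i \<Longrightarrow> f' a \<le> f' b"
      and "\<And>a b. a \<in> ?S \<Longrightarrow> b \<in> ?S \<Longrightarrow> \<forall>i\<in>V. a i \<le> b i \<Longrightarrow> g' a \<le> g' b" for s f' g'
    by (rule insert.IH[OF pos'[OF _ that(1)] ratio'[OF that(1)] that(2,3)])
  have mono: "(\<Sum>x\<in>?S. ?w 1 x) * (\<Sum>x\<in>?S. ?w (-1) x * k (x(v := -1)))
      \<le> (\<Sum>x\<in>?S. ?w (-1) x) * (\<Sum>x\<in>?S. ?w 1 x * k (x(v := 1)))"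
    if k: "\<And>a b. a \<in> insert v V \<rightarrow>\<^sub>E {-1, 1} \<Longrightarrow> b \<in> insert v V \<rightarrow>\<^sub>E {-1, 1} \<Longrightarrow>
        \<forall>i\<in>insert v V. a i \<le> b i \<Longrightarrow> k a \<le> k b" for k :: "('i \<Rightarrow> real) \<Rightarrow> real"
  proof -
    \<comment> \<open>The plus weight is the minus weight tilted by \<open>?\<rho>\<close>, which is
      increasing by the odds condition. The induction hypothesis for \<open>?\<rho>\<close> and
      \<open>k\<close> then compares the two conditional means, after which the spin inside
      \<open>k\<close> is raised.\<close>
    let ?\<rho> = "\<lambda>x. ?w 1 x / ?w (-1) x"
    have w1: "?w 1 x = ?w (-1) x * ?\<rho> x" if "x \<in> ?S" for x
      using pos'[OF that s(2)] by simp
    have \<rho>: "?\<rho> a \<le> ?\<rho> b" if ab: "a \<in> ?S" "b \<in> ?S" "\<forall>i\<in>V. a i \<le> b i" for a b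
    proof -
      have "w (a(v := 1)) * w (b(v := -1)) \<le> w (b(v := 1)) * w (a(v := -1))"
        using ratio[OF insertI1 up1[OF ab(1)] up1[OF ab(2)] le[OF ab(3) order_refl]]
        by (simp only: fun_upd_upd)
      then show ?thesis
        using pos'[OF ab(1) s(2)] pos'[OF ab(2) s(2)] by (simp add: field_simps)
    qed
    have km: "k (a(v := -1)) \<le> k (b(v := -1))"
      if "a \<in> ?S" "b \<in> ?S" "\<forall>i\<in>V. a i \<le> b i" for a b
      by (rule k[OF dn1[OF that(1)] dn1[OF that(2)] le[OF that(3) order_refl]])
    have "(\<Sum>x\<in>?S. ?w 1 x) * (\<Sum>x\<in>?S. ?w (-1) x * k (x(v := -1))) =
        (\<Sum>x\<in>?S. ?w (-1) x * ?\<rho> x) * (\<Sum>x\<in>?S. ?w (-1) x * k (x(v := -1)))"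
      by (intro arg_cong2[where f = "(*)"] sum.cong refl w1)
    also have "\<dots> \<le> (\<Sum>x\<in>?S. ?w (-1) x) * (\<Sum>x\<in>?S. ?w (-1) x * (?\<rho> x * k (x(v := -1))))"
      by (rule IH[OF s(2) \<rho> km])
    also have "\<dots> = (\<Sum>x\<in>?S. ?w (-1) x) * (\<Sum>x\<in>?S. ?w 1 x * k (x(v := -1)))"
      unfolding mult.assoc[symmetric]
      by (intro arg_cong2[where f = "(*)"] sum.cong refl w1[symmetric])
    also have "\<dots> \<le> (\<Sum>x\<in>?S. ?w (-1) x) * (\<Sum>x\<in>?S. ?w 1 x * k (x(v := 1)))"
    proof (intro mult_left_mono sum_mono sum_nonneg)
      fix x assume x: "x \<in> ?S"
      show "k (x(v := -1)) \<le> k (x(v := 1))"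
        by (rule k[OF dn1[OF x] up1[OF x] le]) simp_all
      show "0 \<le> ?w 1 x" "0 \<le> ?w (-1) x"
        using pos'[OF x s(1)] pos'[OF x s(2)] by (simp_all only: less_imp_le)
    qed
    finally show ?thesis .
  qed
  have shift: "k (a(v := s)) \<le> k (b(v := s))"
    if "\<And>a b. a \<in> insert v V \<rightarrow>\<^sub>E {-1, 1} \<Longrightarrow> b \<in> insert v V \<rightarrow>\<^sub>E {-1, 1} \<Longrightarrow>
        \<forall>i\<in>insert v V. a i \<le> b i \<Longrightarrow> k a \<le> k b"
      and "s \<in> {-1, 1}" "a \<in> ?S" "b \<in> ?S" "\<forall>i\<in>V. a i \<le> b i" for k :: "('i \<Rightarrow> real) \<Rightarrow> real" and s a b
    by (rule that(1)[OF up[OF that(3,2)] up[OF that(4,2)] le[OF that(5) order_refl]])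
  show ?case
    unfolding sum_PiE_signs_insert[OF insert.hyps(2)]
  proof (rule fkg_two_point)
    show "0 < (\<Sum>x\<in>?S. ?w 1 x)" "0 < (\<Sum>x\<in>?S. ?w (-1) x)"
      using finS neS by (auto intro!: sum_pos pos' s)
    show "(\<Sum>x\<in>?S. ?w 1 x * f (x(v := 1))) * (\<Sum>x\<in>?S. ?w 1 x * g (x(v := 1)))
      \<le> (\<Sum>x\<in>?S. ?w 1 x) * (\<Sum>x\<in>?S. ?w 1 x * (f (x(v := 1)) * g (x(v := 1))))"
      by (rule IH[OF s(1) shift[OF insert.prems(3) s(1)] shift[OF insert.prems(4) s(1)]])
    show "(\<Sum>x\<in>?S. ?w (-1) x * f (x(v := -1))) * (\<Sum>x\<in>?S. ?w (-1) x * g (x(v := -1)))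
      \<le> (\<Sum>x\<in>?S. ?w (-1) x) * (\<Sum>x\<in>?S. ?w (-1) x * (f (x(v := -1)) * g (x(v := -1))))"
      by (rule IH[OF s(2) shift[OF insert.prems(3) s(2)] shift[OF insert.prems(4) s(2)]])
  qed (rule mono[OF insert.prems(3)] mono[OF insert.prems(4)], assumption+)+
qed

text \<open>The field terms, the pairs avoiding \<open>v\<close> and the pair of \<open>v\<close>
  with itself contribute equally to both exponents. A pair of \<open>v\<close> with another site
  \<open>j\<close> contributes \<open>a j - b j\<close> on the left and \<open>b j - a j\<close> on
  the right, times a nonnegative coupling.\<close>

lemma ising_weight_ratio:
  assumes ferro: "\<And>i j. i \<in> {1..n} \<Longrightarrow> j \<in> {1..n} \<Longrightarrow> 0 \<le> \<beta> * Q i j"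
    and ab: "\<forall>i\<in>{1..n}. a i \<le> b i"
  shows "ising_weight n \<beta> Q \<mu> (a(v := 1)) * ising_weight n \<beta> Q \<mu> (b(v := -1))
       \<le> ising_weight n \<beta> Q \<mu> (b(v := 1)) * ising_weight n \<beta> Q \<mu> (a(v := -1))"
proof -
  let ?H = "\<lambda>x. (\<Sum>i\<in>{1..n}. \<Sum>j\<in>{1..n}. \<beta> * Q i j * (x i * x j)) / 2 + (\<Sum>i\<in>{1..n}. \<mu> i * x i)"
  have H: "ising_weight n \<beta> Q \<mu> x = exp (?H x)" for x
    by (simp add: ising_weight_def sum_distrib_left mult_ac)
  have quad: "\<beta> * Q i j * ((a(v := 1)) i * (a(v := 1)) j) + \<beta> * Q i j * ((b(v := -1)) i * (b(v := -1)) j)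
     \<le> \<beta> * Q i j * ((b(v := 1)) i * (b(v := 1)) j) + \<beta> * Q i j * ((a(v := -1)) i * (a(v := -1)) j)"
    if "i \<in> {1..n}" "j \<in> {1..n}" for i j
    unfolding distrib_left[symmetric] using ferro[OF that] ab that
    by (intro mult_left_mono) auto
  have "(\<Sum>i\<in>{1..n}. \<mu> i * (a(v := 1)) i) + (\<Sum>i\<in>{1..n}. \<mu> i * (b(v := -1)) i) =
      (\<Sum>i\<in>{1..n}. \<mu> i * (b(v := 1)) i) + (\<Sum>i\<in>{1..n}. \<mu> i * (a(v := -1)) i)"
    unfolding sum.distrib[symmetric] by (intro sum.cong) auto
  moreover have "(\<Sum>i\<in>{1..n}. \<Sum>j\<in>{1..n}. \<beta> * Q i j * ((a(v := 1)) i * (a(v := 1)) j)) +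
      (\<Sum>i\<in>{1..n}. \<Sum>j\<in>{1..n}. \<beta> * Q i j * ((b(v := -1)) i * (b(v := -1)) j)) \<le>
      (\<Sum>i\<in>{1..n}. \<Sum>j\<in>{1..n}. \<beta> * Q i j * ((b(v := 1)) i * (b(v := 1)) j)) +
      (\<Sum>i\<in>{1..n}. \<Sum>j\<in>{1..n}. \<beta> * Q i j * ((a(v := -1)) i * (a(v := -1)) j))"
    unfolding sum.distrib[symmetric] by (intro sum_mono quad)
  ultimately have "?H (a(v := 1)) + ?H (b(v := -1)) \<le> ?H (b(v := 1)) + ?H (a(v := -1))"
    by linarith
  then show ?thesis
    unfolding H mult_exp_exp by simp
qed

section \<open>Second moment method for exponential tilts\<close>

lemma gmean_mono:
  assumes "\<And>x. x \<in> \<Omega> \<Longrightarrow> 0 \<le> W x" "\<And>x. x \<in> \<Omega> \<Longrightarrow> f x \<le> g x"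
  shows "gmean \<Omega> W f \<le> gmean \<Omega> W g"
  unfolding gmean_def using assms by (intro divide_right_mono sum_mono mult_left_mono sum_nonneg) auto

lemma gmean_nonneg:
  assumes "\<And>x. x \<in> \<Omega> \<Longrightarrow> 0 \<le> W x" "\<And>x. x \<in> \<Omega> \<Longrightarrow> 0 \<le> f x"
  shows "0 \<le> gmean \<Omega> W f"
  using gmean_mono[of \<Omega> W "\<lambda>_. 0" f] assms by (simp add: gmean_def)

lemma gmean_add: "gmean \<Omega> W (\<lambda>x. f x + g x) = gmean \<Omega> W f + gmean \<Omega> W g"
  by (simp add: gmean_def distrib_left sum.distrib add_divide_distrib)

lemma gmean_diff: "gmean \<Omega> W (\<lambda>x. f x - g x) = gmean \<Omega> W f - gmean \<Omega> W g"
  by (simp add: gmean_def right_diff_distrib sum_subtractf diff_divide_distrib)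

lemma gmean_cmult: "gmean \<Omega> W (\<lambda>x. c * f x) = c * gmean \<Omega> W f"
  by (simp add: gmean_def sum_distrib_left mult_ac)

lemma gmean_sum: "gmean \<Omega> W (\<lambda>x. \<Sum>i\<in>I. f i x) = (\<Sum>i\<in>I. gmean \<Omega> W (f i))"
  by (simp add: gmean_def sum_distrib_left sum_divide_distrib) (rule sum.swap)

lemma gmean_const: "(\<Sum>x\<in>\<Omega>. W x) \<noteq> 0 \<Longrightarrow> gmean \<Omega> W (\<lambda>_. c) = c"
  by (simp add: gmean_def flip: sum_distrib_right)

lemma gcov_centered:
  assumes "(\<Sum>x\<in>\<Omega>. W x) \<noteq> 0"
  shows "gcov \<Omega> W f g = gmean \<Omega> W (\<lambda>x. (f x - gmean \<Omega> W f) * (g x - gmean \<Omega> W g))"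
proof -
  have "(\<lambda>x. (f x - gmean \<Omega> W f) * (g x - gmean \<Omega> W g)) =
      (\<lambda>x. ((f x * g x - gmean \<Omega> W g * f x) - gmean \<Omega> W f * g x) + gmean \<Omega> W f * gmean \<Omega> W g)"
    by (simp add: fun_eq_iff algebra_simps)
  then show ?thesis
    by (simp only: gmean_add gmean_diff gmean_cmult gmean_const[OF assms] gcov_def) simp
qed

lemma gcov_self_nonneg:
  assumes "(\<Sum>x\<in>\<Omega>. W x) \<noteq> 0" "\<And>x. x \<in> \<Omega> \<Longrightarrow> 0 \<le> W x"
  shows "0 \<le> gcov \<Omega> W f f"
  unfolding gcov_centered[OF assms(1)] using assms(2) by (intro gmean_nonneg) simp_all

text \<open>The variance of the absolute value of \<open>f\<close> is nonnegative.\<close>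

lemma gmean_abs_le:
  assumes "(\<Sum>x\<in>\<Omega>. W x) \<noteq> 0" "\<And>x. x \<in> \<Omega> \<Longrightarrow> 0 \<le> W x"
  shows "gmean \<Omega> W (\<lambda>x. \<bar>f x\<bar>) \<le> sqrt (gmean \<Omega> W (\<lambda>x. (f x)\<^sup>2))"
  using gcov_self_nonneg[OF assms, of "\<lambda>x. \<bar>f x\<bar>"] assms(2)
  by (intro real_le_rsqrt) (simp add: gcov_def power2_eq_square flip: abs_mult)

lemma gcov_add_self:
  "gcov \<Omega> W (\<lambda>x. f x + g x) (\<lambda>x. f x + g x) =
     gcov \<Omega> W f f + gcov \<Omega> W g g + 2 * gcov \<Omega> W f g"
proof -
  have "(\<lambda>x. (f x + g x) * (f x + g x)) = (\<lambda>x. (f x * f x + g x * g x) + 2 * (f x * g x))"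
    by (simp add: fun_eq_iff algebra_simps)
  then show ?thesis
    by (simp only: gcov_def gmean_add gmean_cmult) (simp add: algebra_simps)
qed

section \<open>Log-partition functions along a tilt: derivatives and second-order bounds\<close>

lemma DERIV_sum_exp:
  "((\<lambda>t. \<Sum>x\<in>\<Omega>. a x * exp (t * f x)) has_real_derivative (\<Sum>x\<in>\<Omega>. a x * exp (t * f x) * f x)) (at t)"
  by (auto intro!: derivative_eq_intros sum.cong)

lemma DERIV_ln_sum_exp:
  assumes "\<And>t. (\<Sum>x\<in>\<Omega>. W x * exp (t * f x)) > 0"
  shows "((\<lambda>t. ln (\<Sum>x\<in>\<Omega>. W x * exp (t * f x))) has_real_derivative
           gmean \<Omega> (\<lambda>x. W x * exp (t * f x)) f) (at t)"
  by (rule derivative_eq_intros DERIV_sum_exp assms refl)+ (simp add: gmean_def)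

lemma DERIV_gmean_exp:
  assumes "\<And>t. (\<Sum>x\<in>\<Omega>. W x * exp (t * f x)) > 0"
  shows "((\<lambda>t. gmean \<Omega> (\<lambda>x. W x * exp (t * f x)) f) has_real_derivative
           gcov \<Omega> (\<lambda>x. W x * exp (t * f x)) f f) (at t)"
proof -
  have ne: "(\<Sum>x\<in>\<Omega>. W x * exp (t * f x)) \<noteq> 0" for t
    using assms[of t] by simp
  have "((\<lambda>t. \<Sum>x\<in>\<Omega>. W x * exp (t * f x) * f x) has_real_derivative
           (\<Sum>x\<in>\<Omega>. W x * exp (t * f x) * (f x * f x))) (at t)"
    using DERIV_sum_exp[where \<Omega> = \<Omega> and a = "\<lambda>x. W x * f x" and f = f and t = t] by (simp add: mult_ac)
  from DERIV_divide[OF this DERIV_sum_exp ne]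
  show ?thesis
    unfolding gmean_def gcov_def using ne[of t] by (simp add: field_simps)
qed

text \<open>Taylor's formula with Lagrange remainder; the linear term vanishes.\<close>

lemma second_order_upper_bound:
  fixes F F' F'' :: "real \<Rightarrow> real"
  assumes "0 < h" "\<And>t. (F has_real_derivative F' t) (at t)"
    and "\<And>t. (F' has_real_derivative F'' t) (at t)"
    and "F' 0 = 0" "\<And>t. 0 \<le> t \<Longrightarrow> t \<le> h \<Longrightarrow> F'' t \<le> M"
  shows "F h \<le> F 0 + M * h\<^sup>2 / 2"
proof -
  let ?d = "\<lambda>m. if m = 0 then F else if m = (1::nat) then F' else F''"
  have "\<exists>t. 0 < t \<and> t < h \<and> F h = (\<Sum>m<2. ?d m 0 / fact m * h ^ m) + ?d 2 t / fact 2 * h ^ 2"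
    using assms(1-3) by (intro Maclaurin) (auto simp: less_2_cases_iff)
  then obtain t where "0 < t" "t < h" "F h = F 0 + F'' t / 2 * h\<^sup>2"
    using assms(4) by (auto simp: lessThan_Suc eval_nat_numeral)
  then show ?thesis
    using assms(5)[of t] by (simp add: mult_right_mono)
qed

text \<open>The function \<open>ln (Z (2 * t)) - 2 * ln (Z t)\<close> has zero slope at 0 and second
  derivative \<open>4 * V (2 * t) - 2 * V t\<close>. The subtracted variance is dropped, which is
  why only the doubled tilt enters \<open>var\<close>.\<close>

lemma exp_moment_diag:
  assumes fin: "finite \<Omega>" "\<Omega> \<noteq> {}" and pos: "\<And>x. x \<in> \<Omega> \<Longrightarrow> 0 < W x" and A: "0 < A"
    and var: "\<And>t. 0 \<le> t \<Longrightarrow> t \<le> A \<Longrightarrow> gcov \<Omega> (\<lambda>x. W x * exp (2 * t * f x)) f f \<le> r"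
  shows "(\<Sum>x\<in>\<Omega>. W x * exp (2 * A * f x)) * (\<Sum>x\<in>\<Omega>. W x)
       \<le> exp (2 * A\<^sup>2 * r) * (\<Sum>x\<in>\<Omega>. W x * exp (A * f x))\<^sup>2"
proof -
  define Z where "Z t = (\<Sum>x\<in>\<Omega>. W x * exp (t * f x))" for t
  have Z: "Z t > 0" for t
    unfolding Z_def using fin pos by (intro sum_pos) auto
  note Z' = Z[unfolded Z_def]
  define \<mu> where "\<mu> t = gmean \<Omega> (\<lambda>x. W x * exp (t * f x)) f" for t
  define V where "V t = gcov \<Omega> (\<lambda>x. W x * exp (t * f x)) f f" for t
  have D: "((\<lambda>t. ln (Z t)) has_real_derivative \<mu> t) (at t)" for t
    unfolding Z_def \<mu>_def by (rule DERIV_ln_sum_exp[OF Z'])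
  have D': "(\<mu> has_real_derivative V t) (at t)" for t
    unfolding \<mu>_def [abs_def] V_def by (rule DERIV_gmean_exp[OF Z'])
  have "ln (Z (2 * A)) - 2 * ln (Z A) \<le> ln (Z (2 * 0)) - 2 * ln (Z 0) + (4 * r) * A\<^sup>2 / 2"
  proof (rule second_order_upper_bound[where F = "\<lambda>t. ln (Z (2 * t)) - 2 * ln (Z t)"
        and F' = "\<lambda>t. 2 * \<mu> (2 * t) - 2 * \<mu> t" and F'' = "\<lambda>t. 4 * V (2 * t) - 2 * V t"])
    fix t
    show "((\<lambda>t. ln (Z (2 * t)) - 2 * ln (Z t)) has_real_derivative 2 * \<mu> (2 * t) - 2 * \<mu> t) (at t)"
      by (rule derivative_eq_intros DERIV_chain2[OF D] D refl)+ simp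
    show "((\<lambda>t. 2 * \<mu> (2 * t) - 2 * \<mu> t) has_real_derivative 4 * V (2 * t) - 2 * V t) (at t)"
      by (rule derivative_eq_intros DERIV_chain2[OF D'] D' refl)+ simp
    assume t: "0 \<le> t" "t \<le> A"
    have "0 \<le> V t"
      unfolding V_def using Z'[of t] pos by (intro gcov_self_nonneg) (auto simp: less_imp_le)
    with var[OF t] show "4 * V (2 * t) - 2 * V t \<le> 4 * r"
      by (simp add: V_def)
  qed (use A in simp_all)
  then have "ln (Z (2 * A)) + ln (Z 0) \<le> 2 * A\<^sup>2 * r + 2 * ln (Z A)"
    by (simp add: algebra_simps)
  then have "exp (ln (Z (2 * A)) + ln (Z 0)) \<le> exp (2 * A\<^sup>2 * r + (ln (Z A) + ln (Z A)))"
    by simp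
  then have "Z (2 * A) * Z 0 \<le> exp (2 * A\<^sup>2 * r) * (Z A)\<^sup>2"
    using Z by (simp only: exp_add exp_ln power2_eq_square)
  then show ?thesis
    by (simp add: Z_def)
qed

text \<open>The logarithm of the ratio of partition functions has zero slope at 0, because means add
  under a common weight; its second derivative is the combination of variances in
  \<open>var\<close>.\<close>

lemma exp_moment_offdiag:
  assumes fin: "finite \<Omega>" "\<Omega> \<noteq> {}" and pos: "\<And>x. x \<in> \<Omega> \<Longrightarrow> 0 < W x" and A: "0 < A"
    and var: "\<And>t. 0 \<le> t \<Longrightarrow> t \<le> A \<Longrightarrow>
      gcov \<Omega> (\<lambda>x. W x * exp (t * (f x + g x))) (\<lambda>x. f x + g x) (\<lambda>x. f x + g x)
      - gcov \<Omega> (\<lambda>x. W x * exp (t * f x)) f f - gcov \<Omega> (\<lambda>x. W x * exp (t * g x)) g g \<le> M"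
  shows "(\<Sum>x\<in>\<Omega>. W x * exp (A * (f x + g x))) * (\<Sum>x\<in>\<Omega>. W x)
       \<le> exp (A\<^sup>2 * M / 2) * ((\<Sum>x\<in>\<Omega>. W x * exp (A * f x)) * (\<Sum>x\<in>\<Omega>. W x * exp (A * g x)))"
proof -
  define Z where "Z f t = (\<Sum>x\<in>\<Omega>. W x * exp (t * f x))" for f t
  have Z: "Z f t > 0" for f t
    unfolding Z_def using fin pos by (intro sum_pos) auto
  note Z' = Z[unfolded Z_def]
  define \<mu> where "\<mu> f t = gmean \<Omega> (\<lambda>x. W x * exp (t * f x)) f" for f t
  define V where "V f t = gcov \<Omega> (\<lambda>x. W x * exp (t * f x)) f f" for f t
  have D: "((\<lambda>t. ln (Z f t)) has_real_derivative \<mu> f t) (at t)" for f t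
    unfolding Z_def \<mu>_def by (rule DERIV_ln_sum_exp[OF Z'])
  have D': "(\<mu> f has_real_derivative V f t) (at t)" for f t
    unfolding \<mu>_def [abs_def] V_def by (rule DERIV_gmean_exp[OF Z'])
  let ?s = "\<lambda>x. f x + g x"
  have "ln (Z ?s A) - ln (Z f A) - ln (Z g A) \<le> ln (Z ?s 0) - ln (Z f 0) - ln (Z g 0) + M * A\<^sup>2 / 2"
  proof (rule second_order_upper_bound[where F = "\<lambda>t. ln (Z ?s t) - ln (Z f t) - ln (Z g t)"
        and F' = "\<lambda>t. \<mu> ?s t - \<mu> f t - \<mu> g t" and F'' = "\<lambda>t. V ?s t - V f t - V g t"])
    fix t
    show "((\<lambda>t. ln (Z ?s t) - ln (Z f t) - ln (Z g t)) has_real_derivative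
        \<mu> ?s t - \<mu> f t - \<mu> g t) (at t)"
      by (intro DERIV_diff D)
    show "((\<lambda>t. \<mu> ?s t - \<mu> f t - \<mu> g t) has_real_derivative V ?s t - V f t - V g t) (at t)"
      by (intro DERIV_diff D')
  qed (use A var in \<open>simp_all add: \<mu>_def V_def gmean_add\<close>)
  then have "ln (Z ?s A) + ln (Z f 0) \<le> A\<^sup>2 * M / 2 + (ln (Z f A) + ln (Z g A))"
    by (simp add: Z_def algebra_simps)
  then have "exp (ln (Z ?s A) + ln (Z f 0)) \<le> exp (A\<^sup>2 * M / 2 + (ln (Z f A) + ln (Z g A)))"
    by simp
  then have "Z ?s A * Z f 0 \<le> exp (A\<^sup>2 * M / 2) * (Z f A * Z g A)"
    using Z by (simp add: exp_add)
  then show ?thesis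
    by (simp add: Z_def)
qed

text \<open>With \<open>L\<close> the average over \<open>K\<close> of the likelihood ratios, the
  sum of the two errors is at least one minus the mean of \<open>\<bar>L - 1\<bar>\<close>. This
  mean is at most the root of the variance of \<open>L\<close>, which \<open>diag\<close> and
  \<open>offdiag\<close> bound entry by entry.\<close>

lemma second_moment_bound:
  fixes h :: "'s \<Rightarrow> 'a \<Rightarrow> real" and B :: "'a set"
  assumes fin: "finite \<Omega>" "\<Omega> \<noteq> {}" and pos: "\<And>x. x \<in> \<Omega> \<Longrightarrow> 0 < W x"
    and K: "finite K" "K \<noteq> {}" and R': "0 \<le> R'"
    and diag: "\<And>S. S \<in> K \<Longrightarrow> (\<Sum>x\<in>\<Omega>. W x * exp (2 * h S x)) * (\<Sum>x\<in>\<Omega>. W x)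
       \<le> R * (\<Sum>x\<in>\<Omega>. W x * exp (h S x))\<^sup>2"
    and offdiag: "\<And>S S'. S \<in> K \<Longrightarrow> S' \<in> K \<Longrightarrow> S \<noteq> S' \<Longrightarrow>
       (\<Sum>x\<in>\<Omega>. W x * exp (h S x + h S' x)) * (\<Sum>x\<in>\<Omega>. W x)
       \<le> R' * ((\<Sum>x\<in>\<Omega>. W x * exp (h S x)) * (\<Sum>x\<in>\<Omega>. W x * exp (h S' x)))"
  shows "1 - sqrt (R / card K + R' - 1) \<le> gmean \<Omega> W (indicator B) +
     (\<Sum>S\<in>K. gmean \<Omega> (\<lambda>x. W x * exp (h S x)) (indicator (- B))) / card K"
proof -
  define Z where "Z f = (\<Sum>x\<in>\<Omega>. W x * exp (f x))" for f
  have Z: "Z f > 0" for f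
    unfolding Z_def using fin pos by (intro sum_pos) auto
  have Z0: "(\<Sum>x\<in>\<Omega>. W x) = Z (\<lambda>_. 0)"
    by (simp add: Z_def)
  let ?E = "gmean \<Omega> W"
  have W: "(\<Sum>x\<in>\<Omega>. W x) \<noteq> 0" "\<And>x. x \<in> \<Omega> \<Longrightarrow> 0 \<le> W x"
    using Z[of "\<lambda>_. 0"] pos by (auto simp: Z0 less_imp_le)
  define N where "N = real (card K)"
  have N: "N > 0"
    using K by (simp add: N_def card_gt_0_iff)
  \<comment> \<open>The density of the tilted law with respect to the untilted one;
    \<open>change\<close> is the corresponding change of measure.\<close>
  define l where "l S x = exp (h S x) * (Z (\<lambda>_. 0) / Z (h S))" for S x
  define L where "L x = (\<Sum>S\<in>K. l S x) / N" for x
  have change: "?E (\<lambda>x. l S x * f x) = gmean \<Omega> (\<lambda>x. W x * exp (h S x)) f" for S f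
    using Z[of "h S"] Z[of "\<lambda>_. 0"] unfolding gmean_def l_def Z0 Z_def[of "h S", symmetric]
    by (simp add: sum_divide_distrib sum_distrib_left field_simps)
  have El: "?E (l S) = 1" for S
    using change[of S "\<lambda>_. 1"] Z[of "h S"] by (simp add: gmean_const Z_def)
  have EL: "?E L = 1"
  proof -
    have "?E L = ?E (\<lambda>x. (1 / N) * (\<Sum>S\<in>K. l S x))"
      by (simp add: L_def [abs_def])
    also have "\<dots> = (1 / N) * (\<Sum>S\<in>K. ?E (l S))"
      unfolding gmean_cmult gmean_sum ..
    finally show ?thesis
      using N by (simp add: El) (simp add: N_def)
  qed
  have Ell: "?E (\<lambda>x. l S x * l S' x) = Z (\<lambda>x. h S x + h S' x) * Z (\<lambda>_. 0) / (Z (h S) * Z (h S'))" for S S'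
    using Z[of "h S"] Z[of "h S'"] Z[of "\<lambda>_. 0"]
    unfolding gmean_def l_def Z0 Z_def[of "\<lambda>x. h S x + h S' x"]
    by (simp add: sum_divide_distrib sum_distrib_left sum_distrib_right exp_add field_simps)
  \<comment> \<open>Adding \<open>R'\<close> also on the diagonal is harmless as it is nonnegative,
    and makes the double sum exactly \<open>N * R + N\<^sup>2 * R'\<close>.\<close>
  have "?E (\<lambda>x. l S x * l S' x) \<le> (if S' = S then R else 0) + R'" if "S \<in> K" "S' \<in> K" for S S'
  proof (cases "S' = S")
    case True
    have "Z (\<lambda>x. h S x + h S x) * Z (\<lambda>_. 0) \<le> R * (Z (h S) * Z (h S))"
      using diag[OF that(1)] by (simp add: Z_def power2_eq_square)
    then have "?E (\<lambda>x. l S x * l S' x) \<le> R"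
      using Z[of "h S"] True by (simp add: Ell pos_divide_le_eq)
    then show ?thesis
      using True R' by simp
  next
    case False
    have "Z (\<lambda>x. h S x + h S' x) * Z (\<lambda>_. 0) \<le> R' * (Z (h S) * Z (h S'))"
      using offdiag[OF that] False by (simp add: Z_def)
    then show ?thesis
      using Z[of "h S"] Z[of "h S'"] False by (simp add: Ell pos_divide_le_eq)
  qed
  then have "(\<Sum>S\<in>K. \<Sum>S'\<in>K. ?E (\<lambda>x. l S x * l S' x)) \<le> (\<Sum>S\<in>K. \<Sum>S'\<in>K. (if S' = S then R else 0) + R')"
    by (intro sum_mono)
  also have "\<dots> = N * R + N\<^sup>2 * R'"
    using K by (simp add: sum.distrib N_def power2_eq_square algebra_simps)
  finally have LL: "(\<Sum>S\<in>K. \<Sum>S'\<in>K. ?E (\<lambda>x. l S x * l S' x)) \<le> N * R + N\<^sup>2 * R'" .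
  have "?E (\<lambda>x. (L x - 1)\<^sup>2) = ?E (\<lambda>x. (L x)\<^sup>2 - 2 * L x + 1)"
    by (simp add: power2_eq_square algebra_simps)
  also have "\<dots> = ?E (\<lambda>x. (L x)\<^sup>2) - 1"
    by (simp only: gmean_add gmean_diff gmean_cmult EL gmean_const[OF W(1)])
  also have "?E (\<lambda>x. (L x)\<^sup>2) = ?E (\<lambda>x. (1 / N\<^sup>2) * (\<Sum>S\<in>K. \<Sum>S'\<in>K. l S x * l S' x))"
    by (simp add: L_def power_divide power2_eq_square sum_product)
  also have "\<dots> = (1 / N\<^sup>2) * (\<Sum>S\<in>K. \<Sum>S'\<in>K. ?E (\<lambda>x. l S x * l S' x))"
    unfolding gmean_cmult gmean_sum ..
  also have "\<dots> \<le> (1 / N\<^sup>2) * (N * R + N\<^sup>2 * R')"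
    using LL by (intro mult_left_mono) simp_all
  also have "\<dots> = R / N + R'"
    using N by (simp add: field_simps power2_eq_square)
  finally have var: "?E (\<lambda>x. (L x - 1)\<^sup>2) \<le> R / N + R' - 1"
    by simp
  \<comment> \<open>Pointwise, the left side is at most 1 on \<open>B\<close> and at most
    \<open>L x\<close> off \<open>B\<close>.\<close>
  have "?E (\<lambda>x. 1 + (- 1) * \<bar>L x - 1\<bar>) \<le> ?E (\<lambda>x. indicator B x + (1 / N) * (\<Sum>S\<in>K. l S x * indicator (- B) x))"
  proof (rule gmean_mono)
    fix x assume "x \<in> \<Omega>"
    have eq: "(1 / N) * (\<Sum>S\<in>K. l S x * indicator (- B) x) = L x * indicator (- B) x"
      by (simp add: L_def sum_distrib_right)
    then show "1 + (- 1) * \<bar>L x - 1\<bar> \<le> indicator B x + (1 / N) * (\<Sum>S\<in>K. l S x * indicator (- B) x)"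
      unfolding eq by (cases "x \<in> B") simp_all
  qed (rule W)
  then have "1 - ?E (\<lambda>x. \<bar>L x - 1\<bar>) \<le> ?E (indicator B) +
      (1 / N) * (\<Sum>S\<in>K. gmean \<Omega> (\<lambda>x. W x * exp (h S x)) (indicator (- B)))"
    by (simp only: gmean_add gmean_cmult gmean_sum gmean_const[OF W(1)] change)
  moreover have "?E (\<lambda>x. \<bar>L x - 1\<bar>) \<le> sqrt (R / N + R' - 1)"
    using gmean_abs_le[OF W, of "\<lambda>x. L x - 1"] var by (meson order_trans real_sqrt_le_mono)
  ultimately show ?thesis
    by (simp add: N_def)
qed

section \<open>Ising laws as Gibbs means\<close>

lemma set_pmf_ising: "set_pmf (ising n \<beta> Q \<mu>) = spins n"
  using ising_weight_pos[of n \<beta> Q \<mu>] partition_fun_pos[of n \<beta> Q \<mu>]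
  by (auto simp: set_pmf_eq pmf_ising less_le)

lemma sum_ising_weight_pos:
  assumes "\<Omega> \<subseteq> spins n" "\<Omega> \<noteq> {}"
  shows "(\<Sum>x\<in>\<Omega>. ising_weight n \<beta> Q \<mu> x) > 0"
  using assms by (intro sum_pos ising_weight_pos) (auto intro: finite_subset)

lemma prob_ising:
  assumes "\<Omega> \<subseteq> spins n"
  shows "measure_pmf.prob (ising n \<beta> Q \<mu>) \<Omega> =
    (\<Sum>x\<in>\<Omega>. ising_weight n \<beta> Q \<mu> x) / (\<Sum>x\<in>spins n. ising_weight n \<beta> Q \<mu> x)"
proof -
  have "measure_pmf.prob (ising n \<beta> Q \<mu>) \<Omega> = (\<Sum>x\<in>\<Omega>. pmf (ising n \<beta> Q \<mu>) x)"
    using assms by (intro measure_measure_pmf_finite) (auto intro: finite_subset)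
  also have "\<dots> = (\<Sum>x\<in>\<Omega>. ising_weight n \<beta> Q \<mu> x / partition_fun n \<beta> Q \<mu>)"
    using assms by (intro sum.cong) (auto simp: pmf_ising)
  finally show ?thesis
    by (simp add: sum_divide_distrib partition_fun_def)
qed

lemma expectation_ising:
  "measure_pmf.expectation (ising n \<beta> Q \<mu>) f = gmean (spins n) (ising_weight n \<beta> Q \<mu>) f"
proof -
  have "measure_pmf.expectation (ising n \<beta> Q \<mu>) f = (\<Sum>x\<in>spins n. f x * pmf (ising n \<beta> Q \<mu>) x)"
    by (intro integral_measure_pmf_real) (simp_all add: set_pmf_ising)
  then show ?thesis
    by (simp add: pmf_ising gmean_def partition_fun_def sum_divide_distrib mult_ac)
qed

text \<open>Conditioning restricts the sums, and the partition function cancels. Nonemptiness of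
  \<open>\<Omega>\<close> gives it positive mass, so that \<open>cond_pmf\<close> is
  meaningful.\<close>

lemma expectation_cond_ising:
  assumes "\<Omega> \<subseteq> spins n" "\<Omega> \<noteq> {}"
  shows "measure_pmf.expectation (cond_pmf (ising n \<beta> Q \<mu>) \<Omega>) f = gmean \<Omega> (ising_weight n \<beta> Q \<mu>) f"
proof -
  have ne: "set_pmf (ising n \<beta> Q \<mu>) \<inter> \<Omega> \<noteq> {}"
    using assms by (auto simp: set_pmf_ising)
  have Z: "(\<Sum>x\<in>spins n. ising_weight n \<beta> Q \<mu> x) > 0"
    by (intro sum_ising_weight_pos) simp_all
  have "measure_pmf.expectation (cond_pmf (ising n \<beta> Q \<mu>) \<Omega>) f =
      (\<Sum>x\<in>\<Omega>. f x * pmf (cond_pmf (ising n \<beta> Q \<mu>) \<Omega>) x)"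
    using assms by (intro integral_measure_pmf_real) (auto simp: set_cond_pmf[OF ne] intro: finite_subset)
  also have "\<dots> = (\<Sum>x\<in>\<Omega>. ising_weight n \<beta> Q \<mu> x * f x / (\<Sum>x\<in>\<Omega>. ising_weight n \<beta> Q \<mu> x))"
    using assms Z
    by (intro sum.cong refl) (auto simp: pmf_cond[OF ne] pmf_ising prob_ising partition_fun_def)
  finally show ?thesis
    by (simp add: gmean_def sum_divide_distrib)
qed

lemma covariance_ising:
  "covariance (ising n \<beta> Q \<mu>) f g = gcov (spins n) (ising_weight n \<beta> Q \<mu>) f g"
  unfolding covariance_def expectation_ising
  using sum_ising_weight_pos[of "spins n" n \<beta> Q \<mu>] by (subst gcov_centered) simp_all

lemma variance_ising:
  "measure_pmf.variance (ising n \<beta> Q \<mu>) f = gcov (spins n) (ising_weight n \<beta> Q \<mu>) f f"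
  unfolding covariance_ising[symmetric] by (simp add: covariance_def power2_eq_square)

lemma variance_cond_ising:
  assumes "\<Omega> \<subseteq> spins n" "\<Omega> \<noteq> {}"
  shows "measure_pmf.variance (cond_pmf (ising n \<beta> Q \<mu>) \<Omega>) f = gcov \<Omega> (ising_weight n \<beta> Q \<mu>) f f"
  unfolding expectation_cond_ising[OF assms]
  using sum_ising_weight_pos[OF assms, of \<beta> Q \<mu>] by (subst gcov_centered) (simp_all add: power2_eq_square)

text \<open>A crude bound, uniform in the field, which serves to show that a family of variances has
  a genuine supremum.\<close>

lemma gcov_spin_sum_bounds:
  assumes "\<Omega> \<subseteq> spins n" "\<Omega> \<noteq> {}" "S \<subseteq> {1..n}"
  shows "gcov \<Omega> (ising_weight n \<beta> Q \<mu>) (\<lambda>x. \<Sum>i\<in>S. x i) (\<lambda>x. \<Sum>i\<in>S. x i) \<in> {0..(real n)\<^sup>2}"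
proof -
  let ?W = "ising_weight n \<beta> Q \<mu>"
  have ne: "(\<Sum>x\<in>\<Omega>. ?W x) \<noteq> 0"
    using sum_ising_weight_pos[OF assms(1,2), of \<beta> Q \<mu>] by simp
  have W: "0 \<le> ?W x" for x
    using ising_weight_pos[of n \<beta> Q \<mu> x] by simp
  have "gmean \<Omega> ?W (\<lambda>x. (\<Sum>i\<in>S. x i) * (\<Sum>i\<in>S. x i)) \<le> gmean \<Omega> ?W (\<lambda>_. (real n)\<^sup>2)"
  proof (intro gmean_mono W)
    fix x assume "x \<in> \<Omega>"
    then have x: "\<bar>x i\<bar> \<le> 1" if "i \<in> S" for i
      using assms that by (auto simp: spins_def dest!: subsetD dest: PiE_mem)
    have "\<bar>\<Sum>i\<in>S. x i\<bar> \<le> (\<Sum>i\<in>S. \<bar>x i\<bar>)"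
      by (rule sum_abs)
    also have "\<dots> \<le> real (card S)"
      using sum_bounded_above[of S "\<lambda>i. \<bar>x i\<bar>" 1] x by simp
    also have "\<dots> \<le> real n"
      using card_mono[OF _ assms(3)] by simp
    finally have "\<bar>\<Sum>i\<in>S. x i\<bar>\<^sup>2 \<le> (real n)\<^sup>2"
      by (intro power_mono) simp_all
    then show "(\<Sum>i\<in>S. x i) * (\<Sum>i\<in>S. x i) \<le> (real n)\<^sup>2"
      by (simp add: power2_eq_square)
  qed
  also have "\<dots> = (real n)\<^sup>2"
    by (rule gmean_const[OF ne])
  finally have "gcov \<Omega> ?W (\<lambda>x. \<Sum>i\<in>S. x i) (\<lambda>x. \<Sum>i\<in>S. x i) \<le> (real n)\<^sup>2"
    unfolding gcov_def by (smt (verit) zero_le_square)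
  then show ?thesis
    using gcov_self_nonneg[OF ne W] by simp
qed

section \<open>Fields as exponential tilts, and the passage from Gibbs means to the risk\<close>

lemma ising_weight_field_on:
  assumes "S \<subseteq> {1..n}"
  shows "ising_weight n \<beta> Q (field_on S \<eta>) x =
    ising_weight n \<beta> Q (\<lambda>_. 0) x * exp (\<eta> * (\<Sum>i\<in>S. x i))"
proof -
  have "(\<Sum>i\<in>{1..n}. field_on S \<eta> i * x i) = (\<Sum>i\<in>S. \<eta> * x i)"
    using assms by (intro sum.mono_neutral_cong_right) (auto simp: field_on_def)
  then show ?thesis
    by (simp add: ising_weight_def sum_distrib_left exp_add)
qed

text \<open>FKG at zero field, for the indicator of \<open>\<Omega>\<close> and the unnormalised
  density of the tilted law; both are increasing.\<close>

lemma prob_increasing_mono_field: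
  assumes ferro: "\<And>i j. i \<in> {1..n} \<Longrightarrow> j \<in> {1..n} \<Longrightarrow> 0 \<le> \<beta> * Q i j"
    and inc: "increasing_set n \<Omega>" and S: "S \<subseteq> {1..n}" and A: "0 \<le> A"
  shows "measure_pmf.prob (ising n \<beta> Q (\<lambda>_. 0)) \<Omega> \<le> measure_pmf.prob (ising n \<beta> Q (field_on S A)) \<Omega>"
proof -
  let ?W = "ising_weight n \<beta> Q (\<lambda>_. 0)" and ?e = "\<lambda>x. exp (A * (\<Sum>i\<in>S. x i))"
  have sub: "\<Omega> \<subseteq> spins n"
    using inc by (simp add: increasing_set_def)
  have "(\<Sum>x\<in>spins n. ?W x * indicator \<Omega> x) * (\<Sum>x\<in>spins n. ?W x * ?e x)
      \<le> (\<Sum>x\<in>spins n. ?W x) * (\<Sum>x\<in>spins n. ?W x * (indicator \<Omega> x * ?e x))"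
    unfolding spins_def
  proof (rule fkg_inequality)
    fix a b :: "nat \<Rightarrow> real" assume ab: "a \<in> {1..n} \<rightarrow>\<^sub>E {-1, 1}" "b \<in> {1..n} \<rightarrow>\<^sub>E {-1, 1}" "\<forall>i\<in>{1..n}. a i \<le> b i"
    show "indicator \<Omega> a \<le> (indicator \<Omega> b :: real)"
      using inc ab by (auto simp: increasing_set_def spins_def indicator_def)
    show "?e a \<le> ?e b"
      using A S ab(3) by (auto intro!: mult_left_mono sum_mono)
  qed (use ising_weight_pos ising_weight_ratio[OF ferro] in auto)
  moreover have ind: "(\<Sum>x\<in>spins n. k x * indicator \<Omega> x) = (\<Sum>x\<in>\<Omega>. k x)" for k :: "_ \<Rightarrow> real"
    using sub by (intro sum.mono_neutral_cong_right) auto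
  moreover have "(\<Sum>x\<in>spins n. ?W x * (indicator \<Omega> x * ?e x)) = (\<Sum>x\<in>\<Omega>. ?W x * ?e x)"
    using ind[of "\<lambda>x. ?W x * ?e x"] by (simp add: mult_ac)
  ultimately have "(\<Sum>x\<in>\<Omega>. ?W x) * (\<Sum>x\<in>spins n. ?W x * ?e x)
      \<le> (\<Sum>x\<in>spins n. ?W x) * (\<Sum>x\<in>\<Omega>. ?W x * ?e x)"
    by simp
  then show ?thesis
    using sum_ising_weight_pos[of "spins n" n \<beta> Q "\<lambda>_. 0"]
      sum_ising_weight_pos[of "spins n" n \<beta> Q "field_on S A"]
    by (simp add: prob_ising[OF sub] ising_weight_field_on[OF S] field_simps)
qed

text \<open>The left side is the probability of the intersection of \<open>\<Omega>\<close> and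
  \<open>B\<close>.\<close>

lemma prob_ising_ge_cond:
  assumes "\<Omega> \<subseteq> spins n" "\<Omega> \<noteq> {}"
  shows "measure_pmf.prob (ising n \<beta> Q \<mu>) \<Omega> * gmean \<Omega> (ising_weight n \<beta> Q \<mu>) (indicator B)
    \<le> measure_pmf.prob (ising n \<beta> Q \<mu>) B"
proof -
  let ?W = "ising_weight n \<beta> Q \<mu>"
  have "measure_pmf.prob (ising n \<beta> Q \<mu>) \<Omega> * gmean \<Omega> ?W (indicator B) =
      (\<Sum>x\<in>\<Omega>. ?W x * indicator B x) / (\<Sum>x\<in>spins n. ?W x)"
    using sum_ising_weight_pos[OF assms, of \<beta> Q \<mu>] by (simp add: prob_ising[OF assms(1)] gmean_def)
  also have "\<dots> \<le> gmean (spins n) ?W (indicator B)"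
    unfolding gmean_def using assms ising_weight_pos[of n \<beta> Q \<mu>]
    by (intro divide_right_mono sum_mono2 sum_nonneg mult_nonneg_nonneg) (auto simp: less_imp_le)
  also have "\<dots> = measure_pmf.prob (ising n \<beta> Q \<mu>) B"
    by (simp flip: expectation_ising)
  finally show ?thesis .
qed

lemma field_on_in_alternatives:
  assumes "S \<in> \<C>" "S \<subseteq> {1..n}" "0 < A"
  shows "field_on S A \<in> alternatives n \<C> A"
proof -
  have "supp n (field_on S A) = S"
    using assms by (auto simp: supp_def field_on_def)
  then show ?thesis
    using assms by (auto simp: alternatives_def field_on_def)
qed

text \<open>The mixture over \<open>K\<close> of the alternatives \<open>field_on S A\<close> bounds the worst-case error.\<close>

lemma risk_lower_bound:
  assumes ferro: "\<And>i j. i \<in> {1..n} \<Longrightarrow> j \<in> {1..n} \<Longrightarrow> 0 \<le> \<beta> * Q i j"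
    and inc: "increasing_set n \<Omega>" and ne: "\<Omega> \<noteq> {}" and A: "0 < A"
    and K: "K \<subseteq> \<C>" "K \<noteq> {}" "\<And>S. S \<in> K \<Longrightarrow> S \<subseteq> {1..n}" "disjoint K"
    and diag: "\<And>S t. S \<in> K \<Longrightarrow> 0 \<le> t \<Longrightarrow> t \<le> A \<Longrightarrow>
      gcov \<Omega> (ising_weight n \<beta> Q (field_on S (2 * t))) (\<lambda>x. \<Sum>i\<in>S. x i) (\<lambda>x. \<Sum>i\<in>S. x i) \<le> r"
    and offdiag: "\<And>S S' t. S \<in> K \<Longrightarrow> S' \<in> K \<Longrightarrow> S \<noteq> S' \<Longrightarrow> 0 \<le> t \<Longrightarrow> t \<le> A \<Longrightarrow>
      gcov \<Omega> (ising_weight n \<beta> Q (field_on (S \<union> S') t)) (\<lambda>x. \<Sum>i\<in>S \<union> S'. x i) (\<lambda>x. \<Sum>i\<in>S \<union> S'. x i)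
      - gcov \<Omega> (ising_weight n \<beta> Q (field_on S t)) (\<lambda>x. \<Sum>i\<in>S. x i) (\<lambda>x. \<Sum>i\<in>S. x i)
      - gcov \<Omega> (ising_weight n \<beta> Q (field_on S' t)) (\<lambda>x. \<Sum>i\<in>S'. x i) (\<lambda>x. \<Sum>i\<in>S'. x i) \<le> M"
  shows "measure_pmf.prob (ising n \<beta> Q (\<lambda>_. 0)) \<Omega> *
      (1 - sqrt (exp (2 * A\<^sup>2 * r) / card K + exp (A\<^sup>2 * M / 2) - 1)) \<le> risk n \<beta> Q \<C> A T"
proof -
  let ?W = "ising_weight n \<beta> Q" and ?P = "\<lambda>\<mu>. measure_pmf.prob (ising n \<beta> Q \<mu>)"
  let ?u = "\<lambda>S x. \<Sum>i\<in>S. x i :: real"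
  let ?B = "{x. T x}" and ?sup = "SUP \<mu>\<in>alternatives n \<C> A. ?P \<mu> {x. \<not> T x}"
  have sub: "\<Omega> \<subseteq> spins n"
    using inc by (simp add: increasing_set_def)
  then have fin: "finite \<Omega>"
    by (rule finite_subset) simp
  have finK: "finite K"
    using K(3) by (intro finite_subset[of K "Pow {1..n}"]) auto
  then have cardK: "real (card K) > 0"
    using K(2) by (simp add: card_gt_0_iff)
  have finS: "finite S" if "S \<in> K" for S
    using K(3)[OF that] by (rule finite_subset) simp
  have union: "?u (S \<union> S') x = ?u S x + ?u S' x" if "S \<in> K" "S' \<in> K" "S \<noteq> S'" for S S' x
    using that finS disjointD[OF K(4)] by (intro sum.union_disjoint) auto
  define g where "g S = gmean \<Omega> (?W (field_on S A)) (indicator (- ?B))" for S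
  have W: "?W (field_on S t) = (\<lambda>x. ?W (\<lambda>_. 0) x * exp (t * ?u S x))" if "S \<in> K" for S t
    using K(3)[OF that] by (simp add: ising_weight_field_on fun_eq_iff)
  have "1 - sqrt (exp (2 * A\<^sup>2 * r) / card K + exp (A\<^sup>2 * M / 2) - 1) \<le> gmean \<Omega> (?W (\<lambda>_. 0)) (indicator ?B) +
     (\<Sum>S\<in>K. gmean \<Omega> (\<lambda>x. ?W (\<lambda>_. 0) x * exp (A * ?u S x)) (indicator (- ?B))) / card K"
  proof (rule second_moment_bound)
    fix S assume S: "S \<in> K"
    show "(\<Sum>x\<in>\<Omega>. ?W (\<lambda>_. 0) x * exp (2 * (A * ?u S x))) * (\<Sum>x\<in>\<Omega>. ?W (\<lambda>_. 0) x)
       \<le> exp (2 * A\<^sup>2 * r) * (\<Sum>x\<in>\<Omega>. ?W (\<lambda>_. 0) x * exp (A * ?u S x))\<^sup>2"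
      using exp_moment_diag[OF fin ne ising_weight_pos A diag[OF S, unfolded W[OF S]]]
      by (simp add: mult.assoc)
  next
    fix S S' assume S: "S \<in> K" "S' \<in> K" "S \<noteq> S'"
    have WU: "?W (field_on (S \<union> S') t) = (\<lambda>x. ?W (\<lambda>_. 0) x * exp (t * (?u S x + ?u S' x)))" for t
      using K(3) S by (simp add: ising_weight_field_on fun_eq_iff union[OF S])
    show "(\<Sum>x\<in>\<Omega>. ?W (\<lambda>_. 0) x * exp (A * ?u S x + A * ?u S' x)) * (\<Sum>x\<in>\<Omega>. ?W (\<lambda>_. 0) x)
       \<le> exp (A\<^sup>2 * M / 2) * ((\<Sum>x\<in>\<Omega>. ?W (\<lambda>_. 0) x * exp (A * ?u S x)) *
          (\<Sum>x\<in>\<Omega>. ?W (\<lambda>_. 0) x * exp (A * ?u S' x)))"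
      using exp_moment_offdiag[OF fin ne ising_weight_pos A
          offdiag[OF S, unfolded W[OF S(1)] W[OF S(2)] WU union[OF S]]]
      by (simp add: distrib_left)
  qed (use fin ne finK K in \<open>auto intro: ising_weight_pos\<close>)
  also have "\<dots> = gmean \<Omega> (?W (\<lambda>_. 0)) (indicator ?B) + (\<Sum>S\<in>K. g S) / card K"
    by (simp add: g_def W)
  finally have main: "1 - sqrt (exp (2 * A\<^sup>2 * r) / card K + exp (A\<^sup>2 * M / 2) - 1)
      \<le> gmean \<Omega> (?W (\<lambda>_. 0)) (indicator ?B) + (\<Sum>S\<in>K. g S) / card K" .
  \<comment> \<open>The null probability of \<open>\<Omega>\<close> is first replaced by the larger
    one under the alternative, so that multiplying by the conditional error \<open>g S\<close> gives
    a lower bound for the unconditional error. The supremum is finite because probabilities are at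
    most 1.\<close>
  have "?P (\<lambda>_. 0) \<Omega> * g S \<le> ?sup" if S: "S \<in> K" for S
  proof -
    have "0 \<le> g S"
      unfolding g_def by (intro gmean_nonneg) (simp_all add: ising_weight_pos less_imp_le)
    then have "?P (\<lambda>_. 0) \<Omega> * g S \<le> ?P (field_on S A) \<Omega> * g S"
      using prob_increasing_mono_field[OF ferro inc K(3)[OF S] less_imp_le[OF A]]
      by (intro mult_right_mono) simp_all
    also have "\<dots> \<le> ?P (field_on S A) (- ?B)"
      unfolding g_def by (rule prob_ising_ge_cond[OF sub ne])
    also have "- ?B = {x. \<not> T x}"
      by auto
    also have "?P (field_on S A) {x. \<not> T x} \<le> ?sup"
      using S K A by (intro cSUP_upper field_on_in_alternatives bdd_aboveI2[where M = 1]) auto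
    finally show ?thesis .
  qed
  then have "(\<Sum>S\<in>K. ?P (\<lambda>_. 0) \<Omega> * g S) \<le> card K * ?sup"
    by (rule sum_bounded_above)
  then have "?P (\<lambda>_. 0) \<Omega> * ((\<Sum>S\<in>K. g S) / card K) \<le> ?sup"
    unfolding sum_distrib_left[symmetric] using cardK by (simp add: field_simps)
  moreover have "?P (\<lambda>_. 0) \<Omega> * gmean \<Omega> (?W (\<lambda>_. 0)) (indicator ?B) \<le> ?P (\<lambda>_. 0) ?B"
    by (rule prob_ising_ge_cond[OF sub ne])
  moreover have "?P (\<lambda>_. 0) \<Omega> * (1 - sqrt (exp (2 * A\<^sup>2 * r) / card K + exp (A\<^sup>2 * M / 2) - 1)) \<le>
      ?P (\<lambda>_. 0) \<Omega> * (gmean \<Omega> (?W (\<lambda>_. 0)) (indicator ?B) + (\<Sum>S\<in>K. g S) / card K)"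
    by (intro mult_left_mono main) simp
  ultimately show ?thesis
    unfolding risk_def distrib_left by linarith
qed

section \<open>Asymptotics\<close>

text \<open>From \<open>exp (2 * A) \<ge> 1 + 2 * A\<close> one gets
  \<open>A \<le> tanh A * (1 + A)\<close>, and for \<open>tanh A \<le> 1 / 2\<close> the term
  \<open>A * tanh A\<close> is absorbed into half of \<open>A\<close>.\<close>

lemma le_two_tanh:
  fixes A :: real
  assumes "0 < A" "tanh A \<le> 1 / 2"
  shows "A \<le> 2 * tanh A"
proof -
  define E where "E = exp (2 * A)"
  have E: "1 + 2 * A \<le> E"
    unfolding E_def by (rule exp_ge_add_one_self)
  have "exp (- (2 * A)) = 1 / E"
    by (simp add: E_def exp_minus inverse_eq_divide)
  then have "tanh A = (1 - 1 / E) / (1 + 1 / E)"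
    by (simp add: tanh_real_altdef)
  also have "\<dots> = (E - 1) / (E + 1)"
    using E assms(1) by (simp add: divide_simps)
  also have "\<dots> = 1 - 2 / (E + 1)"
    using E assms(1) by (simp add: divide_simps)
  finally have "1 - 2 / (2 + 2 * A) \<le> tanh A"
    using assms E by (simp add: frac_le)
  then have "A \<le> tanh A * (1 + A)"
    using assms by (simp add: field_simps)
  also have "\<dots> \<le> tanh A + A / 2"
    using mult_right_mono[OF assms(2), of A] assms(1) by (simp add: algebra_simps)
  finally show ?thesis
    by simp
qed

text \<open>The condition on \<open>tanh\<close> bounds \<open>A\<^sup>2 * r\<close> by
  \<open>4 * c'\<^sup>2 * ln n\<close> and \<open>A\<^sup>2 * r'\<close> by 1. So the diagonal
  exponential is at most \<open>n\<close> to the power \<open>C\<^sub>l / 2\<close>, against at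
  least \<open>n\<close> to the power \<open>C\<^sub>l\<close> for \<open>N\<close>, while
  \<open>A\<^sup>2 * M\<close> is dominated by \<open>M / r'\<close>.\<close>

lemma risk_error_tendsto_0:
  fixes A r r' N M :: "nat \<Rightarrow> real"
  assumes c: "0 < c'" "c' \<le> 1 / 2" "16 * c'\<^sup>2 \<le> C\<^sub>l" and Cl: "0 < C\<^sub>l"
    and A: "\<forall>\<^sub>F n in sequentially. 0 < A n"
    and r: "\<forall>\<^sub>F n in sequentially. ln (real n) \<le> r n"
    and r': "filterlim r' at_top sequentially"
    and N: "\<forall>\<^sub>F n in sequentially. C\<^sub>l * ln (real n) \<le> ln (N n)"
    and N_pos: "\<forall>\<^sub>F n in sequentially. 0 < N n"
    and M: "M \<in> o(r')"
    and tanh: "\<forall>\<^sub>F n in sequentially. tanh (A n) \<le> c' * min (sqrt (ln (real n) / r n)) (sqrt (1 / r' n))"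
  shows "(\<lambda>n. sqrt (exp (2 * (A n)\<^sup>2 * r n) / N n + exp ((A n)\<^sup>2 * M n / 2) - 1)) \<longlonglongrightarrow> 0"
proof -
  have r'_pos: "\<forall>\<^sub>F n in sequentially. 0 < r' n"
    using r' by (simp add: filterlim_at_top_dense)
  have A_bounds: "\<forall>\<^sub>F n in sequentially. (A n)\<^sup>2 * r n \<le> 4 * c'\<^sup>2 * ln (real n) \<and> (A n)\<^sup>2 * r' n \<le> 1"
    using A r r'_pos tanh eventually_ge_at_top[of 2]
  proof eventually_elim
    case (elim n)
    have ln: "0 < ln (real n)"
      using elim by simp
    have r: "0 < r n"
      using ln elim by linarith
    have t: "tanh (A n) \<le> c' * sqrt (ln (real n) / r n)" "tanh (A n) \<le> c' * sqrt (1 / r' n)"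
      using elim(4) mult_left_mono[OF min.cobounded1 less_imp_le[OF c(1)]]
        mult_left_mono[OF min.cobounded2 less_imp_le[OF c(1)]] by (blast intro: order_trans)+
    \<comment> \<open>The lower bound on \<open>r\<close> enters here: together with
      \<open>c' \<le> 1 / 2\<close> it forces \<open>tanh (A n) \<le> 1 / 2\<close>, so that
      \<open>A n\<close> itself can be controlled.\<close>
    have "sqrt (ln (real n) / r n) \<le> 1"
      using elim ln r by simp
    then have "c' * sqrt (ln (real n) / r n) \<le> 1 / 2"
      using c mult_mono[of c' "1 / 2" "sqrt (ln (real n) / r n)" 1] ln r by simp
    with t have "A n \<le> 2 * tanh (A n)"
      using elim by (intro le_two_tanh) simp_all
    then have A: "A n \<le> 2 * (c' * sqrt (ln (real n) / r n))" "A n \<le> 2 * (c' * sqrt (1 / r' n))"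
      using t by linarith+
    have "(A n)\<^sup>2 \<le> (2 * (c' * sqrt (ln (real n) / r n)))\<^sup>2" "(A n)\<^sup>2 \<le> (2 * (c' * sqrt (1 / r' n)))\<^sup>2"
      by (rule power_mono, rule A, use elim(1) in simp)+
    then have A2: "(A n)\<^sup>2 \<le> 4 * c'\<^sup>2 * (ln (real n) / r n)" "(A n)\<^sup>2 \<le> 4 * c'\<^sup>2 * (1 / r' n)"
      using ln r elim by (simp_all add: power_mult_distrib)
    have "(A n)\<^sup>2 * r n \<le> 4 * c'\<^sup>2 * ln (real n)"
      using A2(1) r by (simp add: field_simps)
    moreover have "(A n)\<^sup>2 * r' n \<le> 4 * c'\<^sup>2"
      using A2(2) elim by (simp add: field_simps)
    moreover have "4 * c'\<^sup>2 \<le> 1"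
      using power_mono[OF c(2), of 2] c(1) by (simp add: power2_eq_square)
    ultimately show ?case
      by linarith
  qed
  have "(\<lambda>n. exp (2 * (A n)\<^sup>2 * r n) / N n) \<longlonglongrightarrow> 0"
  proof (rule tendsto_sandwich)
    show "\<forall>\<^sub>F n in sequentially. 0 \<le> exp (2 * (A n)\<^sup>2 * r n) / N n"
      using N_pos by eventually_elim simp
    show "\<forall>\<^sub>F n in sequentially. exp (2 * (A n)\<^sup>2 * r n) / N n \<le> real n powr (- (C\<^sub>l / 2))"
      using A_bounds N N_pos eventually_ge_at_top[of 2]
    proof eventually_elim
      case (elim n)
      have "4 * c'\<^sup>2 * ln (real n) \<le> C\<^sub>l / 4 * ln (real n)"
        using c(3) elim by (intro mult_right_mono) simp_all
      then have "2 * (A n)\<^sup>2 * r n - ln (N n) \<le> - (C\<^sub>l / 2) * ln (real n)"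
        using elim(1,2) by (simp only: mult.assoc) linarith
      then have "exp (2 * (A n)\<^sup>2 * r n - ln (N n)) \<le> exp (- (C\<^sub>l / 2) * ln (real n))"
        by simp
      then show ?case
        using elim by (simp add: exp_diff powr_def)
    qed
    show "(\<lambda>n. real n powr (- (C\<^sub>l / 2))) \<longlonglongrightarrow> 0"
      using Cl by (intro tendsto_neg_powr filterlim_real_sequentially) simp
  qed simp
  moreover have "(\<lambda>n. (A n)\<^sup>2 * M n) \<longlonglongrightarrow> 0"
  proof (rule Lim_null_comparison)
    show "\<forall>\<^sub>F n in sequentially. norm ((A n)\<^sup>2 * M n) \<le> \<bar>M n / r' n\<bar>"
      using A_bounds r'_pos
    proof eventually_elim
      case (elim n)
      have "(A n)\<^sup>2 * \<bar>M n\<bar> \<le> 1 / r' n * \<bar>M n\<bar>"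
        using elim by (intro mult_right_mono) (simp_all add: field_simps)
      then show ?case
        using elim by (simp add: abs_mult)
    qed
    show "(\<lambda>n. \<bar>M n / r' n\<bar>) \<longlonglongrightarrow> 0"
      using smalloD_tendsto[OF M] by (rule tendsto_rabs_zero)
  qed
  ultimately have "(\<lambda>n. sqrt (exp (2 * (A n)\<^sup>2 * r n) / N n + exp ((A n)\<^sup>2 * M n / 2) - 1))
      \<longlonglongrightarrow> sqrt (0 + exp (0 / 2) - 1)"
    by (intro tendsto_intros) simp_all
  then show ?thesis
    by simp
qed

lemma asymptotically_powerlessI:
  assumes "e \<longlonglongrightarrow> 0"
    and "\<forall>\<^sub>F n in sequentially. 1 - e n \<le> risk n (\<beta> n) (Q n) (\<C> n) (A n) (T n)"
  shows "asymptotically_powerless \<beta> Q \<C> A T"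
proof -
  have "(\<lambda>n. ereal (1 - e n)) \<longlonglongrightarrow> ereal (1 - 0)"
    by (intro tendsto_intros assms)
  then have "1 = liminf (\<lambda>n. ereal (1 - e n))"
    using lim_imp_Liminf[of sequentially "\<lambda>n. ereal (1 - e n)" "ereal (1 - 0)"]
    by (simp only: one_ereal_def diff_zero trivial_limit_sequentially not_False_eq_True)
  also have "\<dots> \<le> liminf (\<lambda>n. ereal (risk n (\<beta> n) (Q n) (\<C> n) (A n) (T n)))"
    using assms(2) by (intro Liminf_mono) simp
  finally show ?thesis
    by (simp add: asymptotically_powerless_def)
qed

text \<open>Eventually \<open>p n\<close> exceeds \<open>\<kappa> / 2\<close> and
  \<open>1 - e n\<close> exceeds one half, which keeps the risk above
  \<open>\<kappa> / 4\<close>.\<close>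

lemma not_asymptotically_powerfulI:
  assumes e: "e \<longlonglongrightarrow> 0" and \<kappa>: "0 < \<kappa>"
    and p: "liminf (\<lambda>n. ereal (p n)) \<ge> ereal \<kappa>"
    and risk: "\<forall>\<^sub>F n in sequentially. p n * (1 - e n) \<le> risk n (\<beta> n) (Q n) (\<C> n) (A n) (T n)"
  shows "\<not> asymptotically_powerful \<beta> Q \<C> A T"
proof -
  have "\<forall>\<^sub>F n in sequentially. ereal (\<kappa> / 2) < ereal (p n)"
    using p \<kappa> by (intro less_LiminfD) (auto intro: less_le_trans[of _ "ereal \<kappa>"])
  moreover have "\<forall>\<^sub>F n in sequentially. e n < 1 / 2"
    using e by (rule order_tendstoD) simp
  ultimately have "\<forall>\<^sub>F n in sequentially. ereal (\<kappa> / 4) \<le> ereal (risk n (\<beta> n) (Q n) (\<C> n) (A n) (T n))"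
    using risk
  proof eventually_elim
    case (elim n)
    have "\<kappa> / 2 * (1 / 2) \<le> p n * (1 - e n)"
      using elim \<kappa> by (intro mult_mono) simp_all
    with elim show ?case
      by simp
  qed
  then have "ereal (\<kappa> / 4) \<le> limsup (\<lambda>n. ereal (risk n (\<beta> n) (Q n) (\<C> n) (A n) (T n)))"
    by (intro le_Limsup) simp_all
  then show ?thesis
    using \<kappa> by (auto simp: asymptotically_powerful_def)
qed

lemma increasing_spins: "increasing_set n (spins n)"
  by (simp add: increasing_set_def)

theorem theorem3:
  fixes \<beta> :: "nat \<Rightarrow> real" and Q :: "nat \<Rightarrow> nat \<Rightarrow> nat \<Rightarrow> real"
    and C\<^sub>l C\<^sub>u \<upsilon> :: real
  assumes constants_pos: "C\<^sub>l > 0" "C\<^sub>u > 0" "\<upsilon> > 0"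
    and sym: "\<And>n i j. n \<ge> 1 \<Longrightarrow> i \<in> {1..n} \<Longrightarrow> j \<in> {1..n} \<Longrightarrow> Q n i j = Q n j i"
    and diag: "\<And>n i. n \<ge> 1 \<Longrightarrow> i \<in> {1..n} \<Longrightarrow> Q n i i = 0"
    and ferromagnetic: "\<And>n i j. n \<ge> 1 \<Longrightarrow> i \<in> {1..n} \<Longrightarrow> j \<in> {1..n} \<Longrightarrow> \<beta> n * Q n i j \<ge> 0"
    and norm_bound: "\<And>n. n \<ge> 1 \<Longrightarrow> inf_norm n (Q n) \<le> C\<^sub>u"
  shows "\<exists>c' > 0. \<exists>C > 0.
    \<forall>(s :: nat \<Rightarrow> nat) (A :: nat \<Rightarrow> real) (\<C> :: nat \<Rightarrow> nat set set) (\<C>' :: nat \<Rightarrow> nat set set).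
      (\<forall>n\<ge>1. s n \<in> {1..n} \<and> A n > 0) \<longrightarrow>
      (\<forall>\<^sub>F n in sequentially. real (s n) \<le> real n powr (1 - \<upsilon>)) \<longrightarrow>
      (\<forall>n\<ge>1. \<forall>S\<in>\<C> n. S \<subseteq> {1..n} \<and> card S = s n) \<longrightarrow>
      (\<forall>n\<ge>1. \<C>' n \<subseteq> \<C> n \<and> disjoint (\<C>' n)) \<longrightarrow>
      (\<forall>\<^sub>F n in sequentially. ln (real (card (\<C>' n))) \<ge> C\<^sub>l * ln (real n)) \<longrightarrow>
      (\<forall>(r :: nat \<Rightarrow> real) (r' :: nat \<Rightarrow> real).
        filterlim r at_top sequentially \<longrightarrow>
        filterlim r' at_top sequentially \<longrightarrow>
        (\<forall>\<^sub>F n in sequentially. r n \<ge> C * ln (real n)) \<longrightarrow>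
        (\<forall>\<^sub>F n in sequentially. \<forall>S\<in>\<C>' n.
           measure_pmf.variance (ising n (\<beta> n) (Q n) (\<lambda>_. 0)) (\<lambda>x. \<Sum>i\<in>S. x i) \<le> r n) \<longrightarrow>
        (\<lambda>n. Sup {covariance (ising n (\<beta> n) (Q n) (\<lambda>_. 0)) (\<lambda>x. \<Sum>i\<in>S1. x i) (\<lambda>x. \<Sum>j\<in>S2. x j)
                   | S1 S2. S1 \<in> \<C>' n \<and> S2 \<in> \<C>' n \<and> S1 \<noteq> S2}) \<in> o(r') \<longrightarrow>
        (\<forall>\<^sub>F n in sequentially. tanh (A n) \<le> c' * min (sqrt (ln (real n) / r n)) (sqrt (1 / r' n))) \<longrightarrow>
        (\<forall>T. asymptotically_powerless \<beta> Q \<C> A T)) \<and>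
      (\<forall>(\<Omega> :: nat \<Rightarrow> (nat \<Rightarrow> real) set) (\<kappa> :: real) (r :: nat \<Rightarrow> real) (r' :: nat \<Rightarrow> real).
        (\<forall>n\<ge>1. increasing_set n (\<Omega> n)) \<longrightarrow>
        \<kappa> > 0 \<longrightarrow>
        filterlim r at_top sequentially \<longrightarrow>
        filterlim r' at_top sequentially \<longrightarrow>
        (\<forall>\<^sub>F n in sequentially. r n \<ge> C * ln (real n)) \<longrightarrow>
        (\<forall>\<^sub>F n in sequentially. \<forall>\<eta>\<in>{0..A n}. \<forall>S\<in>\<C>' n.
           measure_pmf.variance (cond_pmf (ising n (\<beta> n) (Q n) (field_on S (2 * \<eta>))) (\<Omega> n))
             (\<lambda>x. \<Sum>i\<in>S. x i) \<le> r n) \<longrightarrow>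
        (\<lambda>n. Sup {\<bar>measure_pmf.variance (cond_pmf (ising n (\<beta> n) (Q n) (field_on (S1 \<union> S2) \<eta>)) (\<Omega> n))
                      (\<lambda>x. \<Sum>i\<in>S1 \<union> S2. x i)
                  - measure_pmf.variance (cond_pmf (ising n (\<beta> n) (Q n) (field_on S1 \<eta>)) (\<Omega> n))
                      (\<lambda>x. \<Sum>i\<in>S1. x i)
                  - measure_pmf.variance (cond_pmf (ising n (\<beta> n) (Q n) (field_on S2 \<eta>)) (\<Omega> n))
                      (\<lambda>x. \<Sum>i\<in>S2. x i)\<bar>
                   | \<eta> S1 S2. \<eta> \<in> {0..A n} \<and> S1 \<in> \<C>' n \<and> S2 \<in> \<C>' n \<and> S1 \<noteq> S2}) \<in> o(r') \<longrightarrow>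
        liminf (\<lambda>n. ereal (measure_pmf.prob (ising n (\<beta> n) (Q n) (\<lambda>_. 0)) (\<Omega> n))) \<ge> ereal \<kappa> \<longrightarrow>
        (\<forall>\<^sub>F n in sequentially. tanh (A n) \<le> c' * min (sqrt (ln (real n) / r n)) (sqrt (1 / r' n))) \<longrightarrow>
        (\<forall>T. \<not> asymptotically_powerful \<beta> Q \<C> A T))"
proof -
  \<comment> \<open>The bound \<open>1 / 2\<close> is for the comparison of \<open>A\<close> with
    \<open>tanh A\<close>; the other makes the exponent \<open>8 * c'\<^sup>2\<close> of the
    diagonal term at most half of \<open>C\<^sub>l\<close>. The constant \<open>C\<close> is taken
    to be 1.\<close>
  define c' where "c' = min (1 / 2) (sqrt C\<^sub>l / 4)"
  have c': "0 < c'" "c' \<le> 1 / 2"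
    using constants_pos by (simp_all add: c'_def)
  have "c'\<^sup>2 \<le> (sqrt C\<^sub>l / 4)\<^sup>2"
    using c'(1) by (intro power_mono) (simp_all add: c'_def)
  then have c'_Cl: "16 * c'\<^sup>2 \<le> C\<^sub>l"
    using constants_pos by (simp add: power_divide)
  show ?thesis
  proof (rule exI[of _ c'], intro conjI c'(1) exI[of _ 1] allI impI zero_less_one, goal_cases)

    \<comment> \<open>Part (I): unconditioned laws, with variances reduced to zero field by
      GHS\<close>
    case (1 s A \<C> \<C>' r r' T)
    note sA = 1(1) and size = 1(3) and sub = 1(4) and card = 1(5) and r' = 1(7) and r = 1(8)
      and var = 1(9) and cov = 1(10) and tanh = 1(11)
    have K: "\<C>' n \<subseteq> \<C> n" "disjoint (\<C>' n)" "\<And>S. S \<in> \<C>' n \<Longrightarrow> S \<subseteq> {1..n}" if "n \<ge> 1" for n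
      using sub size that by blast+
    have finK: "finite (\<C>' n)" if "n \<ge> 1" for n
      using K(3)[OF that] by (intro finite_subset[of "\<C>' n" "Pow {1..n}"]) auto
    \<comment> \<open>Since \<open>ln 0 = 0\<close>, a cardinality of 0 would violate the
      logarithmic lower bound as soon as \<open>ln n\<close> is positive.\<close>
    have K_pos: "\<forall>\<^sub>F n in sequentially. 0 < real (card (\<C>' n))"
      using card eventually_ge_at_top[of 2]
      by eventually_elim (use constants_pos in \<open>auto intro!: gr0I simp: mult_le_0_iff\<close>)
    let ?u = "\<lambda>S x. \<Sum>i\<in>S. x i :: real"
    let ?cov = "\<lambda>n h S S'. gcov (spins n) (ising_weight n (\<beta> n) (Q n) h) (?u S) (?u S')"
    let ?D = "\<lambda>n. {covariance (ising n (\<beta> n) (Q n) (\<lambda>_. 0)) (\<lambda>x. \<Sum>i\<in>S1. x i) (\<lambda>x. \<Sum>j\<in>S2. x j)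
                   | S1 S2. S1 \<in> \<C>' n \<and> S2 \<in> \<C>' n \<and> S1 \<noteq> S2}"
    \<comment> \<open>The factor 2 before the supremum comes from the cross term in the variance of
      a sum.\<close>
    define e where "e n = sqrt (exp (2 * (A n)\<^sup>2 * r n) / real (card (\<C>' n)) +
        exp ((A n)\<^sup>2 * (2 * Sup (?D n)) / 2) - 1)" for n
    have "e \<longlonglongrightarrow> 0"
      unfolding e_def [abs_def]
    proof (rule risk_error_tendsto_0[OF c' c'_Cl constants_pos(1) _ _ r' card K_pos _ tanh])
      show "\<forall>\<^sub>F n in sequentially. 0 < A n"
        using eventually_ge_at_top[of 1] by eventually_elim (use sA in simp)
      show "(\<lambda>n. 2 * Sup (?D n)) \<in> o(r')"
        using cov by simp
    qed (use r in simp)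
    moreover have "\<forall>\<^sub>F n in sequentially. 1 - e n \<le> risk n (\<beta> n) (Q n) (\<C> n) (A n) (T n)"
      using var K_pos eventually_ge_at_top[of 1]
    proof eventually_elim
      case (elim n)
      have n: "n \<ge> 1"
        by fact
      note ghs = ghs_inequality[OF ferromagnetic[OF n]]
      have fin: "finite (?D n)"
        by (rule finite_subset[OF _ finite_imageI[OF finite_cartesian_product[OF finK[OF n] finK[OF n]],
              of "\<lambda>p. covariance (ising n (\<beta> n) (Q n) (\<lambda>_. 0)) (?u (fst p)) (?u (snd p))"]]) force
      have "measure_pmf.prob (ising n (\<beta> n) (Q n) (\<lambda>_. 0)) (spins n) * (1 - e n)
          \<le> risk n (\<beta> n) (Q n) (\<C> n) (A n) (T n)"
        unfolding e_def
      proof (rule risk_lower_bound[OF ferromagnetic[OF n] increasing_spins])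
        fix S t assume S: "S \<in> \<C>' n" and t: "0 \<le> t" "t \<le> A n"
        have "?cov n (field_on S (2 * t)) S S \<le> ?cov n (\<lambda>_. 0) S S"
          using K(3)[OF n S] t by (intro ghs) (auto simp: field_on_def)
        also have "\<dots> \<le> r n"
          using elim(1) S by (simp add: variance_ising)
        finally show "?cov n (field_on S (2 * t)) S S \<le> r n" .
      next
        fix S S' t assume S: "S \<in> \<C>' n" "S' \<in> \<C>' n" "S \<noteq> S'" and t: "0 \<le> t" "t \<le> A n"
        have "S \<inter> S' = {}"
          using disjointD[OF K(2)[OF n] S] .
        then have u: "?u (S \<union> S') = (\<lambda>x. ?u S x + ?u S' x)"
          using K(3)[OF n] S finite_subset[of _ "{1..n}"] by (intro ext sum.union_disjoint) auto
        let ?h = "field_on (S \<union> S') t"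
        \<comment> \<open>GHS is used in two ways: each single variance is compared with the one in
          the smaller field on its own set, where it cancels against a subtracted term, and the
          cross covariance is compared with the one at zero field.\<close>
        have "?cov n ?h (S \<union> S') (S \<union> S') = ?cov n ?h S S + ?cov n ?h S' S' + 2 * ?cov n ?h S S'"
          unfolding u by (rule gcov_add_self)
        moreover have "?cov n ?h S S \<le> ?cov n (field_on S t) S S"
          using K(3)[OF n] S t by (intro ghs) (auto simp: field_on_def)
        moreover have "?cov n ?h S' S' \<le> ?cov n (field_on S' t) S' S'"
          using K(3)[OF n] S t by (intro ghs) (auto simp: field_on_def)
        moreover have "?cov n ?h S S' \<le> ?cov n (\<lambda>_. 0) S S'"
          using K(3)[OF n] S t by (intro ghs) (auto simp: field_on_def)
        moreover have "?cov n (\<lambda>_. 0) S S' \<le> Sup (?D n)"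
          unfolding covariance_ising[symmetric]
          using S by (intro cSup_upper bdd_above_finite fin) blast
        ultimately show "?cov n ?h (S \<union> S') (S \<union> S') - ?cov n (field_on S t) S S
            - ?cov n (field_on S' t) S' S' \<le> 2 * Sup (?D n)"
          by linarith
      qed (use sA K n elim in auto)
      then show ?case
        using sum_ising_weight_pos[of "spins n" n "\<beta> n" "Q n" "\<lambda>_. 0"] by (simp add: prob_ising)
    qed
    ultimately show ?case
      by (rule asymptotically_powerlessI)
  next

    \<comment> \<open>Part (II): laws conditioned on an increasing event\<close>
    case (2 s A \<C> \<C>' \<Omega> \<kappa> r r' T)
    note sA = 2(1) and size = 2(3) and sub = 2(4) and card = 2(5) and inc = 2(6) and \<kappa> = 2(7)
      and r' = 2(9) and r = 2(10) and var = 2(11) and cov = 2(12) and prob = 2(13) and tanh = 2(14)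
    have K: "\<C>' n \<subseteq> \<C> n" "disjoint (\<C>' n)" "\<And>S. S \<in> \<C>' n \<Longrightarrow> S \<subseteq> {1..n}" if "n \<ge> 1" for n
      using sub size that by blast+
    have K_pos: "\<forall>\<^sub>F n in sequentially. 0 < real (card (\<C>' n))"
      using card eventually_ge_at_top[of 2]
      by eventually_elim (use constants_pos in \<open>auto intro!: gr0I simp: mult_le_0_iff\<close>)
    let ?u = "\<lambda>S x. \<Sum>i\<in>S. x i :: real"
    let ?var = "\<lambda>n \<eta> S. gcov (\<Omega> n) (ising_weight n (\<beta> n) (Q n) (field_on S \<eta>)) (?u S) (?u S)"
    let ?v = "\<lambda>n \<eta> S. measure_pmf.variance (cond_pmf (ising n (\<beta> n) (Q n) (field_on S \<eta>)) (\<Omega> n))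
                      (\<lambda>x. \<Sum>i\<in>S. x i)"
    let ?D = "\<lambda>n. {\<bar>?v n \<eta> (S1 \<union> S2) - ?v n \<eta> S1 - ?v n \<eta> S2\<bar>
                   | \<eta> S1 S2. \<eta> \<in> {0..A n} \<and> S1 \<in> \<C>' n \<and> S2 \<in> \<C>' n \<and> S1 \<noteq> S2}"
    define e where "e n = sqrt (exp (2 * (A n)\<^sup>2 * r n) / real (card (\<C>' n)) +
        exp ((A n)\<^sup>2 * Sup (?D n) / 2) - 1)" for n
    have "e \<longlonglongrightarrow> 0"
      unfolding e_def [abs_def]
    proof (rule risk_error_tendsto_0[OF c' c'_Cl constants_pos(1) _ _ r' card K_pos cov tanh])
      show "\<forall>\<^sub>F n in sequentially. 0 < A n"
        using eventually_ge_at_top[of 1] by eventually_elim (use sA in simp)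
    qed (use r in simp)
    \<comment> \<open>Positive null probability makes \<open>\<Omega> n\<close> nonempty eventually,
      as the formulas for the conditioned laws require.\<close>
    moreover have "\<forall>\<^sub>F n in sequentially. ereal 0 < ereal (measure_pmf.prob (ising n (\<beta> n) (Q n) (\<lambda>_. 0)) (\<Omega> n))"
      using prob \<kappa> by (intro less_LiminfD) (auto intro: less_le_trans[of _ "ereal \<kappa>"])
    then have "\<forall>\<^sub>F n in sequentially. measure_pmf.prob (ising n (\<beta> n) (Q n) (\<lambda>_. 0)) (\<Omega> n) * (1 - e n)
        \<le> risk n (\<beta> n) (Q n) (\<C> n) (A n) (T n)"
      using var K_pos eventually_ge_at_top[of 1]
    proof eventually_elim
      case (elim n)
      have n: "n \<ge> 1"
        by fact
      have \<Omega>: "\<Omega> n \<subseteq> spins n" "\<Omega> n \<noteq> {}"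
        using inc n elim(1) by (auto simp: increasing_set_def)
      note v = variance_cond_ising[OF \<Omega>]
      \<comment> \<open>The parameter \<open>\<eta>\<close> ranges over an interval, so finiteness
        of the class of sets alone does not bound \<open>?D n\<close>; the crude variance bound
        does.\<close>
      have bdd: "bdd_above (?D n)"
      proof (rule bdd_aboveI)
        fix y assume "y \<in> ?D n"
        then obtain \<eta> S1 S2 where y: "y = \<bar>?var n \<eta> (S1 \<union> S2) - ?var n \<eta> S1 - ?var n \<eta> S2\<bar>"
            and S: "S1 \<in> \<C>' n" "S2 \<in> \<C>' n"
          unfolding v by blast
        have "?var n \<eta> (S1 \<union> S2) \<in> {0..(real n)\<^sup>2}" "?var n \<eta> S1 \<in> {0..(real n)\<^sup>2}"
            "?var n \<eta> S2 \<in> {0..(real n)\<^sup>2}"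
          using K(3)[OF n] S by (intro gcov_spin_sum_bounds \<Omega>; simp)+
        then show "y \<le> 2 * (real n)\<^sup>2"
          unfolding y by (simp add: abs_le_iff)
      qed
      show ?case
        unfolding e_def
      proof (rule risk_lower_bound[OF ferromagnetic[OF n]])
        fix S t assume "S \<in> \<C>' n" "0 \<le> t" "t \<le> A n"
        then show "?var n (2 * t) S \<le> r n"
          using elim(2) by (simp add: v)
      next
        fix S S' t assume "S \<in> \<C>' n" "S' \<in> \<C>' n" "S \<noteq> S'" "0 \<le> t" "t \<le> A n"
        then have "\<bar>?v n t (S \<union> S') - ?v n t S - ?v n t S'\<bar> \<le> Sup (?D n)"
          by (intro cSup_upper[OF _ bdd]) auto
        then show "?var n t (S \<union> S') - ?var n t S - ?var n t S' \<le> Sup (?D n)"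
          unfolding v by linarith
      qed (use sA K n elim inc \<Omega> in auto)
    qed
    ultimately show ?case
      using \<kappa> prob by (intro not_asymptotically_powerfulI[where e = e])
  qed
qed

end
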